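(* Let $f$ be a smooth strictly convex function on a domain $\Omega\subset\mathbb{R}^2$, and let $M=\{(x,f(x)) : x\in\Omega\}$ be its graph. Suppose that the cubic form (Fubini-Pick form) $A$ of $M$ is parallel, i.e. $\nabla A=0$, where $\nabla$ is the Levi-Civita connection of the Calabi metric $G$ of $M$. Then $M$ is Calabi affine equivalent to an open part of one of the following surfaces: (i) the elliptic paraboloid; or (ii) one of the surfaces $Q(c_1,\dots,c_r;2)$, with $1\le r\le 2$ and $c_1,\dots,c_r>0$.
   Context: A domain is a nonempty connected open set; strictly convex means that the Hessian matrix $(f_{ij})=(\partial^2 f/\partial x_i\partial x_j)$ is positive definite everywhere. For $n=2$: the Calabi metric of the graph $M=\{(x,f(x)):x\in\Omega\}$ is the Riemannian metric $G=\sum_{i,j} f_{ij}\,dx_i\,dx_j$ (on $\Omega$, equivalently on $M$, using $(x_1,\dots,x_n)$ as global coordinates). The cubic form (Fubini-Pick form) is the totally symmetric $(0,3)$-tensor $A$ with components $A_{ijk}=-\tfrac12\,\partial^3 f/\partial x_i\partial x_j\partial x_k$ in the coordinates $(x_1,\dots,x_n)$. Two graph hypersurfaces in $\mathbb{R}^{n+1}$ are Calabi affine equivalent if one is the image of the other under an affine transformation of $\mathbb{R}^{n+1}$ of the form $X\mapsto \begin{pmatrix} P & 0\\ q & 1\end{pmatrix}X+b$ with $P\in GL(n,\mathbb{R})$, $q$ a constant row vector of length $n$, and $b\in\mathbb{R}^{n+1}$ (that is, an affine transformation whose linear part fixes $Y=(0,\dots,0,1)^t$). The elliptic paraboloid is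 the graph of $x_{n+1}=\tfrac12\sum_{i=1}^n x_i^2$ over $\mathbb{R}^n$. For $1\le r\le n$ and positive numbers $c_1,\dots,c_r$, the hypersurface $Q(c_1,\dots,c_r;n)$ is the graph of $$x_{n+1}=-\sum_{i=1}^r c_i\ln x_i+\sum_{j=r+1}^n\tfrac12x_j^2$$ over $\{(x_1,\dots,x_n): x_1>0,\dots,x_r>0\}$. *)

theory Defs
  imports "HOL-Analysis.Analysis"
begin

section \<open>Smooth functions and partial derivatives\<close>

text \<open>
  Intended for open \<open>S\<close>: all iterated directional derivatives up to order \<open>k\<close> exist and are
  continuous, which for a finite-dimensional domain is \<open>C\<^sup>k\<close> in the usual sense.
\<close>

primrec Ck_on :: "nat \<Rightarrow> 'a::real_normed_vector set \<Rightarrow> ('a \<Rightarrow> 'b::real_normed_vector) \<Rightarrow> bool" where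
  "Ck_on 0 S f \<longleftrightarrow> continuous_on S f"
| "Ck_on (Suc k) S f \<longleftrightarrow> (\<forall>x\<in>S. f differentiable at x) \<and>
     (\<forall>v. Ck_on k S (\<lambda>x. frechet_derivative f (at x) v))"

definition smooth_on :: "'a::real_normed_vector set \<Rightarrow> ('a \<Rightarrow> 'b::real_normed_vector) \<Rightarrow> bool" where
  "smooth_on S f \<longleftrightarrow> (\<forall>k. Ck_on k S f)"

definition partial :: "'n::finite \<Rightarrow> (real^'n \<Rightarrow> real) \<Rightarrow> real^'n \<Rightarrow> real" where
  "partial i f x = frechet_derivative f (at x) (axis i 1)"

definition hessian :: "(real^'n::finite \<Rightarrow> real) \<Rightarrow> real^'n \<Rightarrow> real^'n^'n" where
  "hessian f x = (\<chi> i j. partial i (partial j f) x)"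

definition positive_definite :: "real^'n::finite^'n \<Rightarrow> bool" where
  "positive_definite H \<longleftrightarrow> (\<forall>v. v \<noteq> 0 \<longrightarrow> v \<bullet> (H *v v) > 0)"

definition strictly_convex_on :: "(real^'n::finite) set \<Rightarrow> (real^'n \<Rightarrow> real) \<Rightarrow> bool" where
  "strictly_convex_on S f \<longleftrightarrow> (\<forall>x\<in>S. positive_definite (hessian f x))"

section \<open>Levi-Civita connection and covariant derivative in global coordinates\<close>

text \<open>
  A metric is given by its matrix \<open>g x\<close> at each point; \<open>christoffel g x k i j\<close> is the symbol
  with upper index \<open>k\<close> and lower indices \<open>i\<close>, \<open>j\<close>.
\<close>

definition christoffel ::
    "(real^'n::finite \<Rightarrow> real^'n^'n) \<Rightarrow> real^'n \<Rightarrow> 'n \<Rightarrow> 'n \<Rightarrow> 'n \<Rightarrow> real" where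
  "christoffel g x k i j = 1/2 * (\<Sum>l\<in>UNIV. matrix_inv (g x) $ k $ l *
     (partial i (\<lambda>y. g y $ j $ l) x + partial j (\<lambda>y. g y $ i $ l) x
      - partial l (\<lambda>y. g y $ i $ j) x))"

text \<open>\<open>nabla3 g T x l i j k\<close> is the component \<open>(\<nabla>\<^sub>l T)\<^sub>i\<^sub>j\<^sub>k\<close> at \<open>x\<close> of a \<open>(0,3)\<close>-tensor \<open>T\<close>.\<close>

definition nabla3 :: "(real^'n::finite \<Rightarrow> real^'n^'n) \<Rightarrow> (real^'n \<Rightarrow> 'n \<Rightarrow> 'n \<Rightarrow> 'n \<Rightarrow> real) \<Rightarrow>
    real^'n \<Rightarrow> 'n \<Rightarrow> 'n \<Rightarrow> 'n \<Rightarrow> 'n \<Rightarrow> real" where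
  "nabla3 g T x l i j k = partial l (\<lambda>y. T y i j k) x
     - (\<Sum>m\<in>UNIV. christoffel g x m l i * T x m j k
                 + christoffel g x m l j * T x i m k
                 + christoffel g x m l k * T x i j m)"

definition parallel3_on :: "(real^'n::finite) set \<Rightarrow> (real^'n \<Rightarrow> real^'n^'n) \<Rightarrow>
    (real^'n \<Rightarrow> 'n \<Rightarrow> 'n \<Rightarrow> 'n \<Rightarrow> real) \<Rightarrow> bool" where
  "parallel3_on S g T \<longleftrightarrow> (\<forall>x\<in>S. \<forall>l i j k. nabla3 g T x l i j k = 0)"

lemma partial_cong_open:
  assumes "open S" "x \<in> S" "\<And>y. y \<in> S \<Longrightarrow> f y = h y"
  shows "partial i f x = partial i h x"
proof -
  have "(f has_derivative D) (at x) \<longleftrightarrow> (h has_derivative D) (at x)" for D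
    using has_derivative_transform_within_open[of f D x UNIV S h]
      has_derivative_transform_within_open[of h D x UNIV S f] assms by auto
  then show ?thesis by (simp add: partial_def frechet_derivative_def)
qed

lemma matrix_inv_inverse:
  fixes A :: "real^'n::finite^'n"
  assumes "invertible A"
  shows "A ** matrix_inv A = mat 1" "matrix_inv A ** A = mat 1"
  using someI_ex[OF assms[unfolded invertible_def]] by (simp_all add: matrix_inv_def)

text \<open>
  The Christoffel symbols are the coefficients of the unique torsion-free connection that is
  compatible with the metric.
\<close>

lemma christoffel_unique:
  fixes g :: "real^'n::finite \<Rightarrow> real^'n^'n" and G :: "'n \<Rightarrow> 'n \<Rightarrow> 'n \<Rightarrow> real"
  assumes "open S" "x \<in> S" and sym: "\<And>y. y \<in> S \<Longrightarrow> transpose (g y) = g y"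
    and inv: "invertible (g x)"
  shows "G = christoffel g x \<longleftrightarrow>
    (\<forall>k i j. G k i j = G k j i) \<and>
    (\<forall>k i j. partial k (\<lambda>y. g y $ i $ j) x =
      (\<Sum>m\<in>UNIV. G m k i * g x $ m $ j + G m k j * g x $ i $ m))"
    (is "_ \<longleftrightarrow> ?T G \<and> ?M G")
proof -
  define d where "d k i j = partial k (\<lambda>y. g y $ i $ j) x" for k i j
  have gs: "g y $ i $ j = g y $ j $ i" if "y \<in> S" for y i j
    using arg_cong[OF sym[OF that], of "\<lambda>A. A $ j $ i"] by (simp add: transpose_def)
  have ds: "d k i j = d k j i" for k i j
    unfolding d_def by (rule partial_cong_open[OF assms(1,2)]) (rule gs)
  have gx: "g x $ i $ j = g x $ j $ i" for i j using gs assms(2) by blast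
  define a where "a G i j l = (\<Sum>m\<in>UNIV. g x $ l $ m * G m i j)"
    for G :: "'n \<Rightarrow> 'n \<Rightarrow> 'n \<Rightarrow> real" and i j l
  have a_vec: "a G i j l = (g x *v (\<chi> m. G m i j)) $ l" for G i j l
    by (simp add: a_def matrix_vector_mult_def)
  define b where "b i j l = 1/2 * (d i j l + d j i l - d l i j)" for i j l
  have M_iff: "?M G \<longleftrightarrow> (\<forall>k i j. d k i j = a G k i j + a G k j i)" for G
    unfolding a_def d_def sum.distrib[symmetric]
    by (intro iff_allI arg_cong2[where f="(=)"] refl sum.cong)
      (simp_all add: gx mult.commute)
  have Gb: "G = christoffel g x \<longleftrightarrow> (\<forall>i j l. a G i j l = b i j l)" for G
  proof -
    have chr: "christoffel g x k i j = (matrix_inv (g x) *v (\<chi> l. b i j l)) $ k" for k i j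
      by (simp add: christoffel_def matrix_vector_mult_def b_def d_def sum_distrib_left
          algebra_simps)
    have eqv: "w = matrix_inv (g x) *v v \<longleftrightarrow> g x *v w = v" for v w
      using matrix_inv_inverse[OF inv] by (metis matrix_vector_mul_assoc matrix_vector_mul_lid)
    have "G = christoffel g x \<longleftrightarrow>
      (\<forall>i j. (\<chi> m. G m i j) = matrix_inv (g x) *v (\<chi> l. b i j l))"
      by (auto simp: fun_eq_iff vec_eq_iff chr)
    also have "\<dots> \<longleftrightarrow> (\<forall>i j. g x *v (\<chi> m. G m i j) = (\<chi> l. b i j l))"
      by (simp only: eqv)
    also have "\<dots> \<longleftrightarrow> (\<forall>i j l. a G i j l = b i j l)"
      by (simp add: vec_eq_iff a_vec)
    finally show ?thesis .
  qed
  show ?thesis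
  proof
    assume G: "G = christoffel g x"
    then have ab: "a G i j l = b i j l" for i j l using Gb by blast
    have "?T G"
      unfolding G christoffel_def
      using ds by (simp add: d_def add.commute)
    moreover have "?M G"
      unfolding M_iff ab b_def using ds by (simp add: field_simps)
    ultimately show "?T G \<and> ?M G" ..
  next
    assume TM: "?T G \<and> ?M G"
    then have as: "a G i j l = a G j i l" for i j l by (simp add: a_def)
    have "d k i j = a G k i j + a G k j i" for k i j using TM M_iff by blast
    then have "a G i j l = b i j l" for i j l
      unfolding b_def using as[of i j l] as[of l i j] as[of l j i] by simp
    then show "G = christoffel g x" using Gb by blast
  qed
qed

section \<open>Graph hypersurfaces in Calabi affine geometry\<close>

definition calabi_metric :: "(real^'n::finite \<Rightarrow> real) \<Rightarrow> real^'n \<Rightarrow> real^'n^'n" where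
  "calabi_metric f = hessian f"

definition cubic_form :: "(real^'n::finite \<Rightarrow> real) \<Rightarrow> real^'n \<Rightarrow> 'n \<Rightarrow> 'n \<Rightarrow> 'n \<Rightarrow> real" where
  "cubic_form f x i j k = - 1/2 * partial i (partial j (partial k f)) x"

text \<open>The ambient space of dimension \<open>n + 1\<close> is represented as \<open>(real^'n) \<times> real\<close>.\<close>

definition graph_on :: "(real^'n::finite) set \<Rightarrow> (real^'n \<Rightarrow> real) \<Rightarrow> ((real^'n) \<times> real) set" where
  "graph_on S f = (\<lambda>x. (x, f x)) ` S"

definition calabi_transformation :: "((real^'n::finite) \<times> real \<Rightarrow> (real^'n) \<times> real) \<Rightarrow> bool" where
  "calabi_transformation T \<longleftrightarrow> (\<exists>(P::real^'n^'n) q b. invertible P \<and>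
     (\<forall>x y. T (x, y) = (P *v x, q \<bullet> x + y) + b))"

definition calabi_equivalent :: "((real^'n::finite) \<times> real) set \<Rightarrow> ((real^'n) \<times> real) set \<Rightarrow> bool" where
  "calabi_equivalent M N \<longleftrightarrow> (\<exists>T. calabi_transformation T \<and> N = T ` M)"

lemma calabi_equivalent_sym:
  fixes M N :: "((real^'n::finite) \<times> real) set"
  assumes "calabi_equivalent M N" shows "calabi_equivalent N M"
proof -
  obtain T and P :: "real^'n^'n" and q b where P: "invertible P" and N: "N = T ` M"
    and T: "\<And>x y. T (x, y) = (P *v x, q \<bullet> x + y) + b"
    using assms unfolding calabi_equivalent_def calabi_transformation_def by blast
  define R where "R = matrix_inv P"
  have RP: "R ** P = mat 1" unfolding R_def by (rule matrix_inv_inverse(2)[OF P])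
  have R: "invertible R" unfolding R_def using matrix_inv_inverse[OF P] by (auto simp: invertible_def)
  define q' where "q' = - (transpose R *v q)"
  define b' where "b' = - (R *v fst b, q' \<bullet> fst b + snd b)"
  define T' where "T' = (\<lambda>(x, y). (R *v x, q' \<bullet> x + y) + b')"
  have q': "q' \<bullet> x = - (q \<bullet> (R *v x))" for x
    by (simp add: q'_def dot_lmul_matrix[symmetric])
  have "R *v (P *v x) = x" for x by (simp add: matrix_vector_mul_assoc RP)
  then have "T' (T z) = z" for z
    by (cases z) (simp add: T T'_def b'_def q' plus_prod_def matrix_vector_right_distrib
        inner_add_right)
  then have "M = T' ` N" by (simp add: N image_image)
  moreover have "calabi_transformation T'"
    unfolding calabi_transformation_def T'_def
    by (intro exI[of _ R] exI[of _ q'] exI[of _ b'] conjI allI R) (simp only: prod.case)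
  ultimately show ?thesis unfolding calabi_equivalent_def by blast
qed

definition elliptic_paraboloid :: "((real^'n::finite) \<times> real) set" where
  "elliptic_paraboloid = graph_on UNIV (\<lambda>x. \<Sum>i\<in>UNIV. 1/2 * (x $ i)\<^sup>2)"

text \<open>
  The index type \<open>'n\<close> is meant to be a numeral type, on which \<open>of_nat\<close> restricts to a bijection
  from \<open>{1..CARD('n)}\<close>; the \<open>i\<close>-th coordinate of \<open>x\<close> is thus \<open>x $ of_nat i\<close>.
\<close>

definition Q_surface :: "(nat \<Rightarrow> real) \<Rightarrow> nat \<Rightarrow> ((real^'n::{finite,semiring_1}) \<times> real) set" where
  "Q_surface c r = graph_on {x. \<forall>i\<in>{1..r}. x $ of_nat i > 0}
     (\<lambda>x. - (\<Sum>i=1..r. c i * ln (x $ of_nat i)) + (\<Sum>j=r+1..CARD('n). 1/2 * (x $ of_nat j)\<^sup>2))"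

definition open_part :: "'a::topological_space set \<Rightarrow> 'a set \<Rightarrow> bool" where
  "open_part N S \<longleftrightarrow> N \<noteq> {} \<and> openin (top_of_set S) N"

end

theory Submission
  imports Defs
begin

text \<open>
  Since the metric is a Hessian, \<open>\<nabla>A = 0\<close> expresses the fourth derivatives of \<open>f\<close> as quadratic
  polynomials in the third ones, with coefficients depending on the Hessian. The equality of mixed
  fifth derivatives then says that the curvature times an infinitesimal rotation of \<open>A\<close> vanishes, so
  the metric is flat (where \<open>A = 0\<close> the curvature, being quadratic in \<open>A\<close>, vanishes as well). In dimension two flatness means that the Hessian and its two partial
  derivatives are linearly dependent at each point; hence some constant symmetric tensor is apolar to
  all three at a given point, and, as this pairing satisfies a linear total differential system,
  everywhere. An apolar tensor is indefinite, so it is the symmetric product of two independent vectors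
  \<open>v\<close> and \<open>w\<close> with \<open>f\<^sub>v\<^sub>w = 0\<close>. Along \<open>v\<close> (and likewise \<open>w\<close>) the equation becomes
  \<open>2 h h'' = 3 h'\<^sup>2\<close> for \<open>h = f\<^sub>v\<^sub>v\<close>, that is, \<open>h\<close> to the power \<open>-1/2\<close> is affine; integrating twice
  gives a logarithm or a square in each of the two directions.
\<close>

section \<open>Mixed partial derivatives and total differential systems\<close>

lemma smooth_on_differentiable: "smooth_on S f \<Longrightarrow> x \<in> S \<Longrightarrow> f differentiable at x"
  unfolding smooth_on_def by (metis Ck_on.simps(2))

lemma smooth_on_directional:
  "smooth_on S f \<Longrightarrow> smooth_on S (\<lambda>x. frechet_derivative f (at x) v)"
  unfolding smooth_on_def by (metis Ck_on.simps(2))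

lemma smooth_on_continuous: "smooth_on S f \<Longrightarrow> continuous_on S f"
  unfolding smooth_on_def by (metis Ck_on.simps(1))

lemma DERIV_along_line:
  fixes f :: "'a::real_normed_vector \<Rightarrow> real"
  assumes "f differentiable at (a + t *\<^sub>R u)"
  shows "((\<lambda>s. f (a + s *\<^sub>R u)) has_real_derivative
    frechet_derivative f (at (a + t *\<^sub>R u)) u) (at t)"
proof -
  let ?D = "frechet_derivative f (at (a + t *\<^sub>R u))"
  have D: "(f has_derivative ?D) (at (a + t *\<^sub>R u))"
    using assms frechet_derivative_works by blast
  have "((\<lambda>s. a + s *\<^sub>R u) has_derivative (\<lambda>h. h *\<^sub>R u)) (at t)"
    by (auto intro!: derivative_eq_intros)
  from diff_chain_at[OF this D] have "((\<lambda>s. f (a + s *\<^sub>R u)) has_derivative (\<lambda>h. ?D (h *\<^sub>R u))) (at t)"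
    by (simp add: o_def)
  moreover have "?D (h *\<^sub>R u) = ?D u * h" for h
    using linear_cmul[OF has_derivative_linear[OF D]] by simp
  ultimately show ?thesis by (simp add: has_field_derivative_def)
qed

section \<open>Symmetry of second derivatives\<close>

text \<open>Two uses of the mean value theorem: first along \<open>u\<close>, for the difference of
  \<open>f\<close> between opposite edges of the parallelogram, then along \<open>v\<close>, for the
  derivative of \<open>f\<close> in direction \<open>u\<close>.\<close>

lemma second_difference_mean_value:
  fixes f :: "'a::real_normed_vector \<Rightarrow> real"
  assumes f: "\<And>y. y \<in> S \<Longrightarrow> f differentiable at y"
    and fu: "\<And>y. y \<in> S \<Longrightarrow> (\<lambda>z. frechet_derivative f (at z) u) differentiable at y"
    and S: "\<And>p q. 0 \<le> p \<Longrightarrow> p \<le> s \<Longrightarrow> 0 \<le> q \<Longrightarrow> q \<le> s \<Longrightarrow> x + p *\<^sub>R u + q *\<^sub>R v \<in> S"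
    and "0 < s"
  obtains p q where "0 < p" "p < s" "0 < q" "q < s"
    "f (x + s *\<^sub>R u + s *\<^sub>R v) - f (x + s *\<^sub>R u) - f (x + s *\<^sub>R v) + f x =
      s\<^sup>2 * frechet_derivative (\<lambda>z. frechet_derivative f (at z) u) (at (x + p *\<^sub>R u + q *\<^sub>R v)) v"
proof -
  define g where "g = (\<lambda>y. frechet_derivative f (at y) u)"
  define \<phi> where "\<phi> = (\<lambda>p. f ((x + s *\<^sub>R v) + p *\<^sub>R u) - f (x + p *\<^sub>R u))"
  have S1: "(x + s *\<^sub>R v) + p *\<^sub>R u \<in> S" "x + p *\<^sub>R u \<in> S" if "0 \<le> p" "p \<le> s" for p
    using S[OF that, of s] S[OF that, of 0] \<open>0 < s\<close> by (auto simp: add_ac)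
  have "(\<phi> has_real_derivative g ((x + s *\<^sub>R v) + p *\<^sub>R u) - g (x + p *\<^sub>R u)) (at p)"
    if "0 \<le> p" "p \<le> s" for p
    unfolding \<phi>_def g_def by (intro DERIV_diff DERIV_along_line f S1 that)
  from MVT2[OF \<open>0 < s\<close> this] obtain p where p: "0 < p" "p < s"
    "\<phi> s - \<phi> 0 = (s - 0) * (g ((x + s *\<^sub>R v) + p *\<^sub>R u) - g (x + p *\<^sub>R u))"
    by blast
  have "((\<lambda>q. g ((x + p *\<^sub>R u) + q *\<^sub>R v)) has_real_derivative
      frechet_derivative g (at ((x + p *\<^sub>R u) + q *\<^sub>R v)) v) (at q)"
    if "0 \<le> q" "q \<le> s" for q
    using fu S[of p q] p that unfolding g_def by (intro DERIV_along_line) auto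
  from MVT2[OF \<open>0 < s\<close> this] obtain q where q: "0 < q" "q < s"
    "g ((x + p *\<^sub>R u) + s *\<^sub>R v) - g ((x + p *\<^sub>R u) + 0 *\<^sub>R v)
      = (s - 0) * frechet_derivative g (at ((x + p *\<^sub>R u) + q *\<^sub>R v)) v"
    by blast
  have "\<phi> s - \<phi> 0 = s * (s * frechet_derivative g (at (x + p *\<^sub>R u + q *\<^sub>R v)) v)"
    using p(3) q(3) by (simp add: add_ac)
  then show thesis
    using that[of p q] p q unfolding g_def \<phi>_def by (simp add: power2_eq_square add_ac)
qed

text \<open>The second difference is symmetric in \<open>u\<close> and \<open>v\<close>, so it
  equals \<open>s\<^sup>2\<close> times a value of \<open>A\<close> and also
  \<open>s\<^sup>2\<close> times a value of \<open>B\<close>, both taken close to \<open>x\<close>.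
  Continuity of \<open>A\<close> and \<open>B\<close> at \<open>x\<close> then identifies
  \<open>A x\<close> with \<open>B x\<close>.\<close>

lemma directional_derivatives_commute:
  fixes f :: "'a::real_normed_vector \<Rightarrow> real"
  assumes "open S" "x \<in> S" and f: "smooth_on S f"
  shows "frechet_derivative (\<lambda>y. frechet_derivative f (at y) u) (at x) v =
    frechet_derivative (\<lambda>y. frechet_derivative f (at y) v) (at x) u"
proof -
  define A where "A = (\<lambda>x. frechet_derivative (\<lambda>y. frechet_derivative f (at y) u) (at x) v)"
  define B where "B = (\<lambda>x. frechet_derivative (\<lambda>y. frechet_derivative f (at y) v) (at x) u)"
  have cont: "isCont A x" "isCont B x"
    using smooth_on_continuous[OF smooth_on_directional[OF smooth_on_directional[OF f]]] assms(1,2)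
    unfolding A_def B_def by (simp_all add: continuous_on_eq_continuous_at)
  have "\<bar>A x - B x\<bar> \<le> 0"
  proof (rule field_le_epsilon)
    fix e :: real assume "0 < e"
    obtain d1 where d1: "d1 > 0" "\<And>y. dist y x < d1 \<Longrightarrow> \<bar>A y - A x\<bar> < e/2"
      using cont(1) \<open>0 < e\<close> unfolding continuous_at_eps_delta dist_real_def
      by (meson half_gt_zero)
    obtain d2 where d2: "d2 > 0" "\<And>y. dist y x < d2 \<Longrightarrow> \<bar>B y - B x\<bar> < e/2"
      using cont(2) \<open>0 < e\<close> unfolding continuous_at_eps_delta dist_real_def
      by (meson half_gt_zero)
    obtain d3 where d3: "d3 > 0" "ball x d3 \<subseteq> S"
      using assms(1,2) open_contains_ball by blast
    define d where "d = min d1 (min d2 d3)"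
    have d: "d > 0" using d1 d2 d3 by (simp add: d_def)
    \<comment> \<open>The \<open>+ 1\<close> keeps the denominator positive when \<open>u\<close>
      and \<open>v\<close> both vanish and makes the distance estimate by \<open>d\<close>
      strict.\<close>
    define s where "s = d / (norm u + norm v + 1)"
    have n: "norm u + norm v + 1 > 0" using norm_ge_zero[of u] norm_ge_zero[of v] by linarith
    have s: "s > 0" using d n by (simp add: s_def)
    have near: "dist (x + p *\<^sub>R u + q *\<^sub>R v) x < d" if "0 \<le> p" "p \<le> s" "0 \<le> q" "q \<le> s" for p q
    proof -
      have "dist (x + p *\<^sub>R u + q *\<^sub>R v) x \<le> p * norm u + q * norm v"
        using norm_triangle_ineq[of "p *\<^sub>R u" "q *\<^sub>R v"] that by (simp add: dist_norm add.assoc)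
      also have "\<dots> \<le> s * norm u + s * norm v"
        using that by (intro add_mono mult_right_mono) auto
      also have "\<dots> < s * (norm u + norm v + 1)" using s by (simp add: algebra_simps)
      also have "\<dots> = d" using n by (simp add: s_def)
      finally show ?thesis .
    qed
    have inS: "x + p *\<^sub>R u + q *\<^sub>R v \<in> S" if "0 \<le> p" "p \<le> s" "0 \<le> q" "q \<le> s" for p q
      using near[OF that] d3 by (auto simp: d_def dist_commute subset_eq)
    have inS': "x + q *\<^sub>R v + p *\<^sub>R u \<in> S" if "0 \<le> q" "q \<le> s" "0 \<le> p" "p \<le> s" for p q
      using inS[OF that(3,4,1,2)] by (simp add: add_ac)
    note diffs = smooth_on_differentiable[OF f]
      smooth_on_differentiable[OF smooth_on_directional[OF f]]
    obtain p q where pq: "0 < p" "p < s" "0 < q" "q < s"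
      "f (x + s *\<^sub>R u + s *\<^sub>R v) - f (x + s *\<^sub>R u) - f (x + s *\<^sub>R v) + f x =
        s\<^sup>2 * A (x + p *\<^sub>R u + q *\<^sub>R v)"
      using second_difference_mean_value[OF diffs inS s] unfolding A_def by blast
    obtain p' q' where pq': "0 < p'" "p' < s" "0 < q'" "q' < s"
      "f (x + s *\<^sub>R v + s *\<^sub>R u) - f (x + s *\<^sub>R v) - f (x + s *\<^sub>R u) + f x =
        s\<^sup>2 * B (x + p' *\<^sub>R v + q' *\<^sub>R u)"
      using second_difference_mean_value[OF diffs inS' s] unfolding B_def by blast
    have swap: "x + s *\<^sub>R v + s *\<^sub>R u = x + s *\<^sub>R u + s *\<^sub>R v" by (simp add: add_ac)
    have "s\<^sup>2 * A (x + p *\<^sub>R u + q *\<^sub>R v) = s\<^sup>2 * B (x + p' *\<^sub>R v + q' *\<^sub>R u)"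
      using pq(5) pq'(5)[unfolded swap] by linarith
    then have "A (x + p *\<^sub>R u + q *\<^sub>R v) = B (x + p' *\<^sub>R v + q' *\<^sub>R u)" using s by simp
    moreover have "\<bar>A (x + p *\<^sub>R u + q *\<^sub>R v) - A x\<bar> < e/2"
      using near[of p q] pq by (intro d1) (simp add: d_def)
    moreover have "\<bar>B (x + p' *\<^sub>R v + q' *\<^sub>R u) - B x\<bar> < e/2"
      using near[of q' p'] pq' by (intro d2) (simp add: d_def add_ac)
    ultimately show "\<bar>A x - B x\<bar> \<le> 0 + e" by linarith
  qed
  then show ?thesis by (simp add: A_def B_def)
qed

section \<open>Uniqueness for total differential systems\<close>

text \<open>The zero set is closed by continuity. It is open because, on a small closed ball around
  a zero, the mean value inequality bounds the maximum of \<open>norm (V x)\<close> by half of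
  itself. Connectedness does the rest, so a bound that is only locally uniform suffices.\<close>

lemma zero_propagates:
  fixes V :: "'a::euclidean_space \<Rightarrow> 'b::real_normed_vector"
  assumes "open S" "connected S" and p: "p \<in> S" "V p = 0"
    and V: "\<And>x. x \<in> S \<Longrightarrow> (V has_derivative V' x) (at x)"
    and bound: "\<And>x. x \<in> S \<Longrightarrow>
      \<exists>K. \<forall>\<^sub>F y in nhds x. \<forall>h. norm (V' y h) \<le> K * norm (V y) * norm h"
    and "x \<in> S"
  shows "V x = 0"
proof -
  define Z where "Z = {x \<in> S. V x = 0}"
  have cont: "continuous_on S V"
    using V by (meson has_derivative_continuous continuous_at_imp_continuous_on)
  have "\<exists>r>0. ball z r \<subseteq> Z" if "z \<in> Z" for z
  proof -
    have z: "z \<in> S" "V z = 0" using that by (auto simp: Z_def)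
    obtain K where "\<forall>\<^sub>F y in nhds z. \<forall>h. norm (V' y h) \<le> K * norm (V y) * norm h"
      using bound[OF z(1)] by blast
    then obtain d where d: "d > 0"
      "\<And>y h. dist y z < d \<Longrightarrow> norm (V' y h) \<le> K * norm (V y) * norm h"
      unfolding eventually_nhds_metric by blast
    obtain d' where d': "d' > 0" "ball z d' \<subseteq> S"
      using \<open>open S\<close> z open_contains_ball by blast
    \<comment> \<open>The halves of \<open>d\<close> and \<open>d'\<close> place the closed ball
      inside both open balls; the last term gives \<open>\<bar>K\<bar> * r \<le> 1/2\<close>, the
      contraction factor.\<close>
    define r where "r = min (min (d/2) (d'/2)) (1 / (2 * (\<bar>K\<bar> + 1)))"
    have r: "r > 0" "r < d" "r < d'" using d d' by (auto simp: r_def)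
    have "r \<le> 1 / (2 * (\<bar>K\<bar> + 1))" by (simp add: r_def)
    then have "\<bar>K\<bar> * r + r \<le> 1/2" by (simp add: field_simps)
    then have Kr: "\<bar>K\<bar> * r \<le> 1/2" using r by linarith
    have sub: "cball z r \<subseteq> S" using d' r by (auto simp: subset_eq)
    obtain y where y: "y \<in> cball z r" "\<And>x. x \<in> cball z r \<Longrightarrow> norm (V x) \<le> norm (V y)"
      using continuous_attains_sup[of "cball z r" "\<lambda>x. norm (V x)"] r
        continuous_on_norm[OF continuous_on_subset[OF cont sub]] by auto
    have "norm (V y - V z) \<le> (\<bar>K\<bar> * norm (V y)) * norm (y - z)"
    proof (rule differentiable_bound)
      show "convex (cball z r)" by simp
      show "(V has_derivative V' x) (at x within cball z r)" if "x \<in> cball z r" for x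
        using V that sub has_derivative_at_withinI by blast
      show "onorm (V' x) \<le> \<bar>K\<bar> * norm (V y)" if "x \<in> cball z r" for x
      proof (rule onorm_bound)
        fix h
        have "norm (V' x h) \<le> K * norm (V x) * norm h"
          using d(2)[of x h] that r by (simp add: dist_commute)
        also have "\<dots> \<le> (\<bar>K\<bar> * norm (V y)) * norm h"
          using y(2)[OF that] by (intro mult_right_mono mult_mono) auto
        finally show "norm (V' x h) \<le> \<bar>K\<bar> * norm (V y) * norm h" .
      qed simp
    qed (use y r in auto)
    also have "\<dots> \<le> (\<bar>K\<bar> * norm (V y)) * r"
      using y(1) by (intro mult_left_mono) (auto simp: dist_norm norm_minus_commute)
    also have "\<dots> = (\<bar>K\<bar> * r) * norm (V y)" by simp
    also have "\<dots> \<le> 1/2 * norm (V y)" using Kr by (intro mult_right_mono) auto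
    finally have "norm (V y) \<le> 0" using z(2) by simp
    then have "ball z r \<subseteq> Z" using y(2) sub by (force simp: Z_def)
    then show ?thesis using r by blast
  qed
  then have "open Z" unfolding open_contains_ball by blast
  then have "openin (top_of_set S) Z"
    by (auto simp: Z_def intro: open_subset)
  moreover have "closedin (top_of_set S) Z"
    unfolding Z_def by (rule continuous_closedin_preimage_constant[OF cont])
  ultimately have "Z = S" using \<open>connected S\<close> p unfolding connected_clopen by (auto simp: Z_def)
  then show ?thesis using \<open>x \<in> S\<close> by (auto simp: Z_def)
qed

section \<open>Jets in the plane\<close>

definition gradient_on ::
    "(real^2) set \<Rightarrow> (real^2 \<Rightarrow> real) \<Rightarrow> (real^2 \<Rightarrow> real) \<Rightarrow> (real^2 \<Rightarrow> real) \<Rightarrow> bool" where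
  "gradient_on S u u\<^sub>1 u\<^sub>2 \<longleftrightarrow>
     (\<forall>x\<in>S. (u has_derivative (\<lambda>h. u\<^sub>1 x * h $ 1 + u\<^sub>2 x * h $ 2)) (at x))"

lemma partial_eqI:
  assumes "gradient_on S u u\<^sub>1 u\<^sub>2" "x \<in> S"
  shows "partial 1 u x = u\<^sub>1 x" "partial 2 u x = u\<^sub>2 x"
proof -
  have "frechet_derivative u (at x) = (\<lambda>h. u\<^sub>1 x * h $ 1 + u\<^sub>2 x * h $ 2)"
    using assms frechet_derivative_at[of u _ x] unfolding gradient_on_def by metis
  then show "partial 1 u x = u\<^sub>1 x" "partial 2 u x = u\<^sub>2 x"
    by (simp_all add: partial_def axis_def)
qed

lemma gradient_on_partial:
  assumes "smooth_on S u"
  shows "gradient_on S u (partial 1 u) (partial 2 u)"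
  unfolding gradient_on_def
proof
  fix x assume "x \<in> S"
  let ?D = "frechet_derivative u (at x)"
  have D: "(u has_derivative ?D) (at x)"
    using smooth_on_differentiable[OF assms \<open>x \<in> S\<close>] frechet_derivative_works by blast
  have "?D h = partial 1 u x * h $ 1 + partial 2 u x * h $ 2" for h
  proof -
    have "h = h $ 1 *\<^sub>R axis 1 1 + h $ 2 *\<^sub>R axis 2 1"
      by (simp add: vec_eq_iff forall_2 axis_def)
    then have "?D h = ?D (h $ 1 *\<^sub>R axis 1 1 + h $ 2 *\<^sub>R axis 2 1)" by simp
    also have "\<dots> = h $ 1 * ?D (axis 1 1) + h $ 2 * ?D (axis 2 1)"
      using has_derivative_linear[OF D] by (simp add: linear_add linear_cmul)
    finally show ?thesis by (simp add: partial_def)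
  qed
  with D show "(u has_derivative (\<lambda>h. partial 1 u x * h $ 1 + partial 2 u x * h $ 2)) (at x)"
    by (metis (no_types, lifting) ext)
qed

lemma smooth_on_partial: "smooth_on S u \<Longrightarrow> smooth_on S (partial i u)"
  unfolding partial_def[abs_def] by (rule smooth_on_directional)

lemma smooth_on_partial_funpow: "smooth_on S u \<Longrightarrow> smooth_on S ((partial i ^^ n) u)"
  by (induction n) (auto intro: smooth_on_partial)

lemma partial_commute:
  assumes "open S" "x \<in> S" "smooth_on S u"
  shows "partial i (partial j u) x = partial j (partial i u) x"
  unfolding partial_def[abs_def] by (rule directional_derivatives_commute[OF assms])

lemma partial_funpow_commute:
  assumes "open S" "x \<in> S" "smooth_on S u"
  shows "partial i ((partial j ^^ n) u) x = (partial j ^^ n) (partial i u) x"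
  using \<open>x \<in> S\<close>
proof (induction n arbitrary: x)
  case (Suc n)
  have "partial i (partial j ((partial j ^^ n) u)) x = partial j (partial i ((partial j ^^ n) u)) x"
    by (intro partial_commute[OF assms(1) Suc.prems] smooth_on_partial_funpow assms)
  also have "\<dots> = partial j ((partial j ^^ n) (partial i u)) x"
    by (rule partial_cong_open[OF assms(1) Suc.prems Suc.IH])
  finally show ?case by simp
qed simp

text \<open>One representative of each mixed derivative: the derivatives in the second variable are
  taken first. Where \<open>f\<close> is smooth on an open set all other orders agree with it, so
  the symmetry is built into the indices.\<close>

definition jet :: "(real^2 \<Rightarrow> real) \<Rightarrow> nat \<Rightarrow> nat \<Rightarrow> real^2 \<Rightarrow> real" where
  "jet f i j = (partial 1 ^^ i) ((partial 2 ^^ j) f)"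

text \<open>Raising the first index is the definition; raising the second moves
  \<open>partial 2\<close> inwards past \<open>i\<close> copies of \<open>partial 1\<close>.\<close>

lemma gradient_on_jet:
  assumes "open S" "smooth_on S f"
  shows "gradient_on S (jet f i j) (jet f (Suc i) j) (jet f i (Suc j))"
proof -
  have s\<^sub>2: "smooth_on S ((partial 2 ^^ j) f)"
    using assms(2) by (rule smooth_on_partial_funpow)
  then have s: "smooth_on S (jet f i j)"
    unfolding jet_def by (rule smooth_on_partial_funpow)
  have "partial 2 (jet f i j) x = jet f i (Suc j) x" if "x \<in> S" for x
    using partial_funpow_commute[OF assms(1) that s\<^sub>2, where i = 2 and j = 1 and n = i]
    by (simp add: jet_def)
  with gradient_on_partial[OF s] show ?thesis
    unfolding gradient_on_def by (simp add: jet_def)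
qed

lemma partial_jet:
  assumes "open S" "smooth_on S f" "x \<in> S"
  shows "partial 1 (jet f i j) x = jet f (Suc i) j x" "partial 2 (jet f i j) x = jet f i (Suc j) x"
  using partial_eqI[OF gradient_on_jet[OF assms(1,2)] assms(3)] by blast+

lemma partial_partial_eq_jet:
  assumes "open S" "smooth_on S f" "x \<in> S"
  shows "partial 1 (partial 1 f) x = jet f 2 0 x" "partial 1 (partial 2 f) x = jet f 1 1 x"
    "partial 2 (partial 1 f) x = jet f 1 1 x" "partial 2 (partial 2 f) x = jet f 0 2 x"
  using partial_jet[OF assms, of "Suc 0" 0] partial_jet[OF assms, of 0 "Suc 0"]
  by (simp_all add: jet_def eval_nat_numeral)

lemma partial_partial_partial_eq_jet:
  assumes "open S" "smooth_on S f" "x \<in> S"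
  shows "partial 1 (partial 1 (partial 1 f)) x = jet f 3 0 x"
    "partial 1 (partial 1 (partial 2 f)) x = jet f 2 1 x"
    "partial 1 (partial 2 (partial 1 f)) x = jet f 2 1 x"
    "partial 1 (partial 2 (partial 2 f)) x = jet f 1 2 x"
    "partial 2 (partial 1 (partial 1 f)) x = jet f 2 1 x"
    "partial 2 (partial 1 (partial 2 f)) x = jet f 1 2 x"
    "partial 2 (partial 2 (partial 1 f)) x = jet f 1 2 x"
    "partial 2 (partial 2 (partial 2 f)) x = jet f 0 3 x"
proof -
  have "partial i (partial j (partial k f)) x = partial i u x"
    if "\<And>y. y \<in> S \<Longrightarrow> partial j (partial k f) y = u y" for i j k u
    by (rule partial_cong_open[OF assms(1,3) that])
  note P = this[OF partial_partial_eq_jet(1)[OF assms(1,2)]]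
     this[OF partial_partial_eq_jet(2)[OF assms(1,2)]]
     this[OF partial_partial_eq_jet(3)[OF assms(1,2)]]
     this[OF partial_partial_eq_jet(4)[OF assms(1,2)]]
  show "partial 1 (partial 1 (partial 1 f)) x = jet f 3 0 x"
    "partial 1 (partial 1 (partial 2 f)) x = jet f 2 1 x"
    "partial 1 (partial 2 (partial 1 f)) x = jet f 2 1 x"
    "partial 1 (partial 2 (partial 2 f)) x = jet f 1 2 x"
    "partial 2 (partial 1 (partial 1 f)) x = jet f 2 1 x"
    "partial 2 (partial 1 (partial 2 f)) x = jet f 1 2 x"
    "partial 2 (partial 2 (partial 1 f)) x = jet f 1 2 x"
    "partial 2 (partial 2 (partial 2 f)) x = jet f 0 3 x"
    by (simp_all only: P partial_jet[OF assms] eval_nat_numeral BitM.simps One_nat_def)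
qed

section \<open>Definiteness and inverses of 2 by 2 matrices\<close>

lemma positive_definite_2:
  fixes H :: "real^2^2"
  assumes "positive_definite H" "H $ 1 $ 2 = H $ 2 $ 1"
  shows "H $ 1 $ 1 > 0" "H $ 1 $ 1 * H $ 2 $ 2 - (H $ 1 $ 2)\<^sup>2 > 0"
proof -
  have Q: "v \<bullet> (H *v v) = H $ 1 $ 1 * (v $ 1)\<^sup>2 + 2 * H $ 1 $ 2 * v $ 1 * v $ 2 + H $ 2 $ 2 * (v $ 2)\<^sup>2" for v
    using assms(2) by (simp add: inner_vec_def matrix_vector_mult_def sum_2 algebra_simps power2_eq_square)
  have pos: "H $ 1 $ 1 * s\<^sup>2 + 2 * H $ 1 $ 2 * s * t + H $ 2 $ 2 * t\<^sup>2 > 0" if "s \<noteq> 0 \<or> t \<noteq> 0" for s t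
    using assms(1) that unfolding positive_definite_def
    by (auto dest!: spec[of _ "vector [s, t]"] simp: Q vec_eq_iff forall_2)
  from pos[of 1 0] show E: "H $ 1 $ 1 > 0" by simp
  \<comment> \<open>At the test vector with entries \<open>- H $ 1 $ 2\<close> and
    \<open>H $ 1 $ 1\<close> the form takes the value \<open>H $ 1 $ 1\<close> times the
    determinant.\<close>
  have "H $ 1 $ 1 * (- H $ 1 $ 2)\<^sup>2 + 2 * H $ 1 $ 2 * (- H $ 1 $ 2) * H $ 1 $ 1 + H $ 2 $ 2 * (H $ 1 $ 1)\<^sup>2 > 0"
    using E by (intro pos) simp
  also have "H $ 1 $ 1 * (- H $ 1 $ 2)\<^sup>2 + 2 * H $ 1 $ 2 * (- H $ 1 $ 2) * H $ 1 $ 1 + H $ 2 $ 2 * (H $ 1 $ 1)\<^sup>2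
    = H $ 1 $ 1 * (H $ 1 $ 1 * H $ 2 $ 2 - (H $ 1 $ 2)\<^sup>2)"
    by (simp add: algebra_simps power2_eq_square)
  finally show "H $ 1 $ 1 * H $ 2 $ 2 - (H $ 1 $ 2)\<^sup>2 > 0"
    using E by (simp add: zero_less_mult_iff)
qed

text \<open>\<open>matrix_inv\<close> is a Hilbert choice, so explicit entries come from uniqueness;
  a right inverse of a square matrix is two-sided.\<close>

lemma matrix_inv_unique:
  fixes A B :: "real^'n^'n"
  assumes "A ** B = mat 1"
  shows "matrix_inv A = B"
proof -
  have "B ** A = mat 1" using assms matrix_left_right_inverse by blast
  then have "matrix_inv A ** (A ** B) = B"
    using matrix_inv_inverse(2)[of A] assms
    by (metis invertible_def matrix_mul_assoc matrix_mul_lid)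
  then show ?thesis by (simp add: assms matrix_mul_rid)
qed

lemma matrix_inv_2:
  fixes H :: "real^2^2"
  assumes "H $ 1 $ 1 * H $ 2 $ 2 - H $ 1 $ 2 * H $ 2 $ 1 \<noteq> 0" (is "?D \<noteq> 0")
  shows "matrix_inv H $ 1 $ 1 = H $ 2 $ 2 / ?D" "matrix_inv H $ 1 $ 2 = - H $ 1 $ 2 / ?D"
    "matrix_inv H $ 2 $ 1 = - H $ 2 $ 1 / ?D" "matrix_inv H $ 2 $ 2 = H $ 1 $ 1 / ?D"
proof -
  define B :: "real^2^2" where
    "B = vector [vector [H $ 2 $ 2 / ?D, - H $ 1 $ 2 / ?D], vector [- H $ 2 $ 1 / ?D, H $ 1 $ 1 / ?D]]"
  have "H ** B = mat 1"
    using assms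
    by (simp add: B_def vec_eq_iff forall_2 matrix_matrix_mult_def sum_2 mat_def)
      (simp add: diff_divide_distrib[symmetric] mult.commute[of "H $ 2 $ 2"]
        mult.commute[of "H $ 2 $ 1"])
  then have "matrix_inv H = B" by (rule matrix_inv_unique)
  then show "matrix_inv H $ 1 $ 1 = H $ 2 $ 2 / ?D" "matrix_inv H $ 1 $ 2 = - H $ 1 $ 2 / ?D"
    "matrix_inv H $ 2 $ 1 = - H $ 2 $ 1 / ?D" "matrix_inv H $ 2 $ 2 = H $ 1 $ 1 / ?D"
    by (simp_all add: B_def)
qed

section \<open>The equation for the fourth derivatives\<close>

locale parallel_cubic_form =
  fixes \<Omega> :: "(real^2) set" and f :: "real^2 \<Rightarrow> real"
  assumes domain: "open \<Omega>" "connected \<Omega>"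
    and smooth: "smooth_on \<Omega> f" and convex: "strictly_convex_on \<Omega> f"
    and parallel: "parallel3_on \<Omega> (calabi_metric f) (cubic_form f)"
begin

abbreviation "J \<equiv> jet f"

text \<open>
  \<open>Delta\<close> is the determinant of the Hessian and \<open>dualprod\<close> is \<open>Delta\<close> times the inner product that the
  Hessian induces on covectors, so that no denominators occur.
\<close>

definition "Delta x = J 2 0 x * J 0 2 x - (J 1 1 x)\<^sup>2" for x

definition "dualprod x u\<^sub>1 u\<^sub>2 v\<^sub>1 v\<^sub>2 =
  J 0 2 x * u\<^sub>1 * v\<^sub>1 - J 1 1 x * (u\<^sub>1 * v\<^sub>2 + u\<^sub>2 * v\<^sub>1) + J 2 0 x * u\<^sub>2 * v\<^sub>2" for x and u\<^sub>1 u\<^sub>2 v\<^sub>1 v\<^sub>2 :: real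

lemma hessian_eq_jet:
  assumes "x \<in> \<Omega>"
  shows "hessian f x $ 1 $ 1 = J 2 0 x" "hessian f x $ 1 $ 2 = J 1 1 x"
    "hessian f x $ 2 $ 1 = J 1 1 x" "hessian f x $ 2 $ 2 = J 0 2 x"
  using partial_partial_eq_jet[OF domain(1) smooth assms] by (simp_all add: hessian_def)

lemma Hessian_positive:
  assumes "x \<in> \<Omega>"
  shows "J 2 0 x > 0" "Delta x > 0" "J 0 2 x > 0"
proof -
  show E: "J 2 0 x > 0" and D: "Delta x > 0"
    using positive_definite_2[of "hessian f x"] convex assms
    unfolding strictly_convex_on_def Delta_def by (auto simp: hessian_eq_jet)
  have "J 2 0 x * J 0 2 x > 0" using D zero_le_power2[of "J 1 1 x"] unfolding Delta_def by linarith
  then show "J 0 2 x > 0" using E by (simp add: zero_less_mult_iff)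
qed

lemma partial_hessian_eq_jet:
  assumes "x \<in> \<Omega>"
  shows "partial 1 (\<lambda>y. hessian f y $ 1 $ 1) x = J 3 0 x"
    "partial 1 (\<lambda>y. hessian f y $ 1 $ 2) x = J 2 1 x"
    "partial 1 (\<lambda>y. hessian f y $ 2 $ 1) x = J 2 1 x"
    "partial 1 (\<lambda>y. hessian f y $ 2 $ 2) x = J 1 2 x"
    "partial 2 (\<lambda>y. hessian f y $ 1 $ 1) x = J 2 1 x"
    "partial 2 (\<lambda>y. hessian f y $ 1 $ 2) x = J 1 2 x"
    "partial 2 (\<lambda>y. hessian f y $ 2 $ 1) x = J 1 2 x"
    "partial 2 (\<lambda>y. hessian f y $ 2 $ 2) x = J 0 3 x"
  using partial_partial_partial_eq_jet[OF domain(1) smooth assms]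
  by (simp_all add: hessian_def)

text \<open>For a Hessian metric the three metric derivatives in a Christoffel symbol are one and
  the same third derivative of \<open>f\<close>, so the bracket collapses to a single term. The
  factor \<open>2 * Delta x\<close> clears the denominators of Cramer's rule.\<close>

lemma christoffel_eq:
  assumes "x \<in> \<Omega>"
  shows "2 * Delta x * christoffel (calabi_metric f) x 1 1 1 = J 0 2 x * J 3 0 x - J 1 1 x * J 2 1 x"
    "2 * Delta x * christoffel (calabi_metric f) x 2 1 1 = J 2 0 x * J 2 1 x - J 1 1 x * J 3 0 x"
    "2 * Delta x * christoffel (calabi_metric f) x 1 2 1 = J 0 2 x * J 2 1 x - J 1 1 x * J 1 2 x"
    "2 * Delta x * christoffel (calabi_metric f) x 2 2 1 = J 2 0 x * J 1 2 x - J 1 1 x * J 2 1 x"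
    "2 * Delta x * christoffel (calabi_metric f) x 1 2 2 = J 0 2 x * J 1 2 x - J 1 1 x * J 0 3 x"
    "2 * Delta x * christoffel (calabi_metric f) x 2 2 2 = J 2 0 x * J 0 3 x - J 1 1 x * J 1 2 x"
proof -
  note H = hessian_eq_jet[OF assms]
  have det: "hessian f x $ 1 $ 1 * hessian f x $ 2 $ 2 - hessian f x $ 1 $ 2 * hessian f x $ 2 $ 1 = Delta x"
    by (simp add: H Delta_def power2_eq_square)
  then have nz: "hessian f x $ 1 $ 1 * hessian f x $ 2 $ 2 - hessian f x $ 1 $ 2 * hessian f x $ 2 $ 1 \<noteq> 0"
    using Hessian_positive[OF assms] by simp
  note inv = matrix_inv_2[OF nz, unfolded det, unfolded H]
  show "2 * Delta x * christoffel (calabi_metric f) x 1 1 1 = J 0 2 x * J 3 0 x - J 1 1 x * J 2 1 x"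
    "2 * Delta x * christoffel (calabi_metric f) x 2 1 1 = J 2 0 x * J 2 1 x - J 1 1 x * J 3 0 x"
    "2 * Delta x * christoffel (calabi_metric f) x 1 2 1 = J 0 2 x * J 2 1 x - J 1 1 x * J 1 2 x"
    "2 * Delta x * christoffel (calabi_metric f) x 2 2 1 = J 2 0 x * J 1 2 x - J 1 1 x * J 2 1 x"
    "2 * Delta x * christoffel (calabi_metric f) x 1 2 2 = J 0 2 x * J 1 2 x - J 1 1 x * J 0 3 x"
    "2 * Delta x * christoffel (calabi_metric f) x 2 2 2 = J 2 0 x * J 0 3 x - J 1 1 x * J 1 2 x"
    using Hessian_positive[OF assms]
    by (simp_all add: christoffel_def calabi_metric_def sum_2 partial_hessian_eq_jet[OF assms] inv
        field_simps)
qed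

lemma partial_cubic_form:
  assumes "x \<in> \<Omega>" "gradient_on \<Omega> u u\<^sub>1 u\<^sub>2"
    and "\<And>y. y \<in> \<Omega> \<Longrightarrow> partial i (partial j (partial k f)) y = u y"
  shows "partial 1 (\<lambda>y. cubic_form f y i j k) x = - 1/2 * u\<^sub>1 x"
    "partial 2 (\<lambda>y. cubic_form f y i j k) x = - 1/2 * u\<^sub>2 x"
proof -
  have "gradient_on \<Omega> (\<lambda>y. - 1/2 * u y) (\<lambda>y. - 1/2 * u\<^sub>1 y) (\<lambda>y. - 1/2 * u\<^sub>2 y)"
    using assms(2) unfolding gradient_on_def by (auto intro!: derivative_eq_intros simp: algebra_simps)
  from partial_eqI[OF this assms(1)]
  show "partial 1 (\<lambda>y. cubic_form f y i j k) x = - 1/2 * u\<^sub>1 x"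
    "partial 2 (\<lambda>y. cubic_form f y i j k) x = - 1/2 * u\<^sub>2 x"
    using partial_cong_open[OF domain(1) assms(1), of "\<lambda>y. cubic_form f y i j k" "\<lambda>y. - 1/2 * u y"]
    by (simp_all add: cubic_form_def assms(3))
qed

text \<open>Each Christoffel term of \<open>nabla3\<close> pairs two rows of third derivatives
  through the inverse Hessian. Hence \<open>2 * Delta x\<close> times a fourth derivative is the
  sum, over the three ways of splitting its four indices into two pairs, of the corresponding
  \<open>dualprod\<close>; the coefficients 3, 1 and 2 count equal splittings.\<close>

lemma fourth_derivatives:
  assumes "x \<in> \<Omega>"
  shows "2 * Delta x * J 4 0 x = 3 * dualprod x (J 3 0 x) (J 2 1 x) (J 3 0 x) (J 2 1 x)"
    "2 * Delta x * J 3 1 x = 3 * dualprod x (J 3 0 x) (J 2 1 x) (J 2 1 x) (J 1 2 x)"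
    "2 * Delta x * J 2 2 x = dualprod x (J 3 0 x) (J 2 1 x) (J 1 2 x) (J 0 3 x)
       + 2 * dualprod x (J 2 1 x) (J 1 2 x) (J 2 1 x) (J 1 2 x)"
    "2 * Delta x * J 1 3 x = 3 * dualprod x (J 2 1 x) (J 1 2 x) (J 1 2 x) (J 0 3 x)"
    "2 * Delta x * J 0 4 x = 3 * dualprod x (J 1 2 x) (J 0 3 x) (J 1 2 x) (J 0 3 x)"
proof -
  have g: "gradient_on \<Omega> (J i j) (J (Suc i) j) (J i (Suc j))" for i j
    by (rule gradient_on_jet[OF domain(1) smooth])
  note P = partial_partial_partial_eq_jet[OF domain(1) smooth]
  \<comment> \<open>This choice of components hits each of the five fourth derivatives exactly
    once.\<close>
  have dA: "partial 1 (\<lambda>y. cubic_form f y 1 1 1) x = - 1/2 * J 4 0 x"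
    "partial 2 (\<lambda>y. cubic_form f y 1 1 1) x = - 1/2 * J 3 1 x"
    "partial 2 (\<lambda>y. cubic_form f y 2 1 1) x = - 1/2 * J 2 2 x"
    "partial 2 (\<lambda>y. cubic_form f y 2 2 1) x = - 1/2 * J 1 3 x"
    "partial 2 (\<lambda>y. cubic_form f y 2 2 2) x = - 1/2 * J 0 4 x"
    using partial_cubic_form[OF assms g P(1)] partial_cubic_form(2)[OF assms g P(5)]
      partial_cubic_form(2)[OF assms g P(7)] partial_cubic_form(2)[OF assms g P(8)]
    by (simp_all add: eval_nat_numeral)
  have A: "cubic_form f x i j k = - 1/2 * partial i (partial j (partial k f)) x" for i j k
    by (simp add: cubic_form_def)
  have par: "nabla3 (calabi_metric f) (cubic_form f) x l i j k = 0" for l i j k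
    using parallel assms unfolding parallel3_on_def by blast
  note eqs = par[unfolded nabla3_def sum_2]
  note rews = dA A P[OF assms]
  show "2 * Delta x * J 4 0 x = 3 * dualprod x (J 3 0 x) (J 2 1 x) (J 3 0 x) (J 2 1 x)"
    using eqs[of 1 1 1 1, unfolded rews] christoffel_eq[OF assms]
    unfolding dualprod_def by algebra
  show "2 * Delta x * J 3 1 x = 3 * dualprod x (J 3 0 x) (J 2 1 x) (J 2 1 x) (J 1 2 x)"
    using eqs[of 2 1 1 1, unfolded rews] christoffel_eq[OF assms]
    unfolding dualprod_def by algebra
  show "2 * Delta x * J 2 2 x = dualprod x (J 3 0 x) (J 2 1 x) (J 1 2 x) (J 0 3 x)
       + 2 * dualprod x (J 2 1 x) (J 1 2 x) (J 2 1 x) (J 1 2 x)"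
    using eqs[of 2 2 1 1, unfolded rews] christoffel_eq[OF assms]
    unfolding dualprod_def by algebra
  show "2 * Delta x * J 1 3 x = 3 * dualprod x (J 2 1 x) (J 1 2 x) (J 1 2 x) (J 0 3 x)"
    using eqs[of 2 2 2 1, unfolded rews] christoffel_eq[OF assms]
    unfolding dualprod_def by algebra
  show "2 * Delta x * J 0 4 x = 3 * dualprod x (J 1 2 x) (J 0 3 x) (J 1 2 x) (J 0 3 x)"
    using eqs[of 2 2 2 2, unfolded rews] christoffel_eq[OF assms]
    unfolding dualprod_def by algebra
qed

end

section \<open>Flatness\<close>

context parallel_cubic_form
begin

lemma has_derivative_jet:
  assumes "x \<in> \<Omega>"
  shows "(J i j has_derivative (\<lambda>h. J (Suc i) j x * h $ 1 + J i (Suc j) x * h $ 2)) (at x)"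
  using gradient_on_jet[OF domain(1) smooth] assms unfolding gradient_on_def by blast

definition "dJ x i j h = J (Suc i) j x * h $ 1 + J i (Suc j) x * h $ 2" for x and h :: "real^2"

definition "dDelta x h = dJ x 2 0 h * J 0 2 x + J 2 0 x * dJ x 0 2 h - 2 * J 1 1 x * dJ x 1 1 h" for x h

text \<open>The differential along \<open>h\<close> of the coefficients of \<open>dualprod\<close>
  alone, with its four slots frozen; the product rule adds the terms in which a slot is
  differentiated.\<close>

definition "ddual x h u\<^sub>1 u\<^sub>2 v\<^sub>1 v\<^sub>2 =
  dJ x 0 2 h * u\<^sub>1 * v\<^sub>1 - dJ x 1 1 h * (u\<^sub>1 * v\<^sub>2 + u\<^sub>2 * v\<^sub>1) + dJ x 2 0 h * u\<^sub>2 * v\<^sub>2"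
  for x h and u\<^sub>1 u\<^sub>2 v\<^sub>1 v\<^sub>2 :: real

lemma has_derivative_dJ:
  assumes "x \<in> \<Omega>"
  shows "(J i j has_derivative dJ x i j) (at x)"
  using has_derivative_jet[OF assms] by (simp add: dJ_def[abs_def])

lemma has_derivative_Delta_mult:
  assumes x: "x \<in> \<Omega>"
  shows "((\<lambda>y. 2 * Delta y * J i j y) has_derivative
     (\<lambda>h. 2 * dDelta x h * J i j x + 2 * Delta x * dJ x i j h)) (at x)"
  unfolding Delta_def dDelta_def
  by (rule derivative_eq_intros has_derivative_dJ[OF x] refl)+
    (simp add: fun_eq_iff algebra_simps power2_eq_square)

lemma has_derivative_dualprod:
  assumes x: "x \<in> \<Omega>"
  shows "((\<lambda>y. dualprod y (J i j y) (J k l y) (J m n y) (J p q y)) has_derivative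
     (\<lambda>h. dualprod x (dJ x i j h) (dJ x k l h) (J m n x) (J p q x)
        + dualprod x (J i j x) (J k l x) (dJ x m n h) (dJ x p q h)
        + ddual x h (J i j x) (J k l x) (J m n x) (J p q x))) (at x)"
  unfolding dualprod_def ddual_def
  by (rule derivative_eq_intros has_derivative_dJ[OF x] refl)+
    (simp add: fun_eq_iff algebra_simps)

lemma derivatives_agree:
  assumes "x \<in> \<Omega>" "(u has_derivative u') (at x)" "(w has_derivative w') (at x)"
    and "\<And>y. y \<in> \<Omega> \<Longrightarrow> u y = w y"
  shows "u' h = w' h"
proof -
  have "(w has_derivative u') (at x)"
    by (rule has_derivative_transform_within_open[OF assms(2) domain(1) assms(1,4)])
  then show ?thesis using assms(3) has_derivative_unique by blast
qed

text \<open>Both sides of each fourth-order equation agree on an open set, so their derivatives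
  agree in every direction \<open>h\<close>. The two coordinate directions yield the fifth
  derivatives.\<close>

lemma fourth_derivatives_differentiated:
  assumes x: "x \<in> \<Omega>"
  shows "2 * dDelta x h * J 4 0 x + 2 * Delta x * dJ x 4 0 h =
      3 * (dualprod x (dJ x 3 0 h) (dJ x 2 1 h) (J 3 0 x) (J 2 1 x)
        + dualprod x (J 3 0 x) (J 2 1 x) (dJ x 3 0 h) (dJ x 2 1 h)
        + ddual x h (J 3 0 x) (J 2 1 x) (J 3 0 x) (J 2 1 x))" (is ?A)
    "2 * dDelta x h * J 3 1 x + 2 * Delta x * dJ x 3 1 h =
      3 * (dualprod x (dJ x 3 0 h) (dJ x 2 1 h) (J 2 1 x) (J 1 2 x)
        + dualprod x (J 3 0 x) (J 2 1 x) (dJ x 2 1 h) (dJ x 1 2 h)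
        + ddual x h (J 3 0 x) (J 2 1 x) (J 2 1 x) (J 1 2 x))" (is ?B)
    "2 * dDelta x h * J 2 2 x + 2 * Delta x * dJ x 2 2 h =
      (dualprod x (dJ x 3 0 h) (dJ x 2 1 h) (J 1 2 x) (J 0 3 x)
        + dualprod x (J 3 0 x) (J 2 1 x) (dJ x 1 2 h) (dJ x 0 3 h)
        + ddual x h (J 3 0 x) (J 2 1 x) (J 1 2 x) (J 0 3 x))
      + 2 * (dualprod x (dJ x 2 1 h) (dJ x 1 2 h) (J 2 1 x) (J 1 2 x)
        + dualprod x (J 2 1 x) (J 1 2 x) (dJ x 2 1 h) (dJ x 1 2 h)
        + ddual x h (J 2 1 x) (J 1 2 x) (J 2 1 x) (J 1 2 x))" (is ?C)
    "2 * dDelta x h * J 1 3 x + 2 * Delta x * dJ x 1 3 h =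
      3 * (dualprod x (dJ x 2 1 h) (dJ x 1 2 h) (J 1 2 x) (J 0 3 x)
        + dualprod x (J 2 1 x) (J 1 2 x) (dJ x 1 2 h) (dJ x 0 3 h)
        + ddual x h (J 2 1 x) (J 1 2 x) (J 1 2 x) (J 0 3 x))" (is ?D)
    "2 * dDelta x h * J 0 4 x + 2 * Delta x * dJ x 0 4 h =
      3 * (dualprod x (dJ x 1 2 h) (dJ x 0 3 h) (J 1 2 x) (J 0 3 x)
        + dualprod x (J 1 2 x) (J 0 3 x) (dJ x 1 2 h) (dJ x 0 3 h)
        + ddual x h (J 1 2 x) (J 0 3 x) (J 1 2 x) (J 0 3 x))" (is ?E)
proof -
  note d = has_derivative_Delta_mult[OF x] has_derivative_dualprod[OF x]
    has_derivative_mult_right[OF has_derivative_dualprod[OF x]]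
  note agree = derivatives_agree[OF x d(1)]
  show ?A by (rule agree[OF d(3) fourth_derivatives(1)])
  show ?B by (rule agree[OF d(3) fourth_derivatives(2)])
  show ?C by (rule agree[OF has_derivative_add[OF d(2) d(3)] fourth_derivatives(3)])
  show ?D by (rule agree[OF d(3) fourth_derivatives(4)])
  show ?E by (rule agree[OF d(3) fourth_derivatives(5)])
qed

text \<open>
  The determinant with rows \<open>(f\<^sub>1\<^sub>1, f\<^sub>1\<^sub>2, f\<^sub>2\<^sub>2)\<close>, \<open>(f\<^sub>1\<^sub>1\<^sub>1, f\<^sub>1\<^sub>1\<^sub>2, f\<^sub>1\<^sub>2\<^sub>2)\<close>, \<open>(f\<^sub>1\<^sub>1\<^sub>2, f\<^sub>1\<^sub>2\<^sub>2, f\<^sub>2\<^sub>2\<^sub>2)\<close>, which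
  is the Gauss curvature of the Hessian metric up to a nonvanishing factor.
\<close>

definition "flatness x =
  J 2 0 x * (J 2 1 x * J 0 3 x - (J 1 2 x)\<^sup>2) - J 1 1 x * (J 3 0 x * J 0 3 x - J 2 1 x * J 1 2 x)
    + J 0 2 x * (J 3 0 x * J 1 2 x - (J 2 1 x)\<^sup>2)" for x

text \<open>The Ricci identity in coordinates: curvature times the infinitesimal rotation of the
  cubic form vanishes. A rotation of the plane acts on cubic forms without kernel, so nonzero
  curvature would force all third derivatives to vanish, and with them
  \<open>flatness x\<close>.\<close>

lemma flatness_zero:
  assumes x: "x \<in> \<Omega>"
  shows "flatness x = 0"
proof -
  define e\<^sub>1 e\<^sub>2 :: "real^2" where "e\<^sub>1 = axis 1 1" and "e\<^sub>2 = axis 2 1"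
  have dJ: "dJ x i j e\<^sub>1 = J (Suc i) j x" "dJ x i j e\<^sub>2 = J i (Suc j) x" for i j
    by (simp_all add: dJ_def e\<^sub>1_def e\<^sub>2_def axis_def)
  have S: "Suc 0 = 1" "Suc 1 = 2" "Suc 2 = 3" "Suc 3 = 4" "Suc 4 = 5" by simp_all
  note expansions = dDelta_def ddual_def dualprod_def Delta_def flatness_def dJ S
  note F = fourth_derivatives_differentiated[OF x]
  note Q = fourth_derivatives[OF x]
  txt \<open>Each equation compares the two ways of obtaining one mixed fifth derivative of \<open>f\<close>.\<close>
  have 1: "flatness x * (J 2 0 x * J 2 1 x - J 1 1 x * J 3 0 x) = 0"
    using F(1)[of e\<^sub>2] F(2)[of e\<^sub>1] Q(1,2,3) unfolding expansions by algebra
  have 2: "flatness x * (2 * J 2 0 x * J 1 2 x - J 1 1 x * J 2 1 x - J 0 2 x * J 3 0 x) = 0"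
    using F(2)[of e\<^sub>2] F(3)[of e\<^sub>1] Q(1,2,3,4) unfolding expansions by algebra
  have 3: "flatness x * (J 2 0 x * J 0 3 x + J 1 1 x * J 1 2 x - 2 * J 0 2 x * J 2 1 x) = 0"
    using F(3)[of e\<^sub>2] F(4)[of e\<^sub>1] Q(2,3,4,5) unfolding expansions by algebra
  have 4: "flatness x * (J 1 1 x * J 0 3 x - J 0 2 x * J 1 2 x) = 0"
    using F(4)[of e\<^sub>2] F(5)[of e\<^sub>1] Q(3,4,5) unfolding expansions by algebra
  show ?thesis
  proof (rule ccontr)
    assume nz: "flatness x \<noteq> 0"
    have D: "Delta x \<noteq> 0" and E: "J 2 0 x \<noteq> 0" using Hessian_positive[OF x] by auto
    have lin: "J 2 0 x * J 2 1 x - J 1 1 x * J 3 0 x = 0"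
      "2 * J 2 0 x * J 1 2 x - J 1 1 x * J 2 1 x - J 0 2 x * J 3 0 x = 0"
      "J 2 0 x * J 0 3 x + J 1 1 x * J 1 2 x - 2 * J 0 2 x * J 2 1 x = 0"
      "J 1 1 x * J 0 3 x - J 0 2 x * J 1 2 x = 0"
      using 1 2 3 4 nz by simp_all
    \<comment> \<open>Eliminating the other three unknowns from the four linear relations leaves
      \<open>J 3 0 x\<close> with a nonzero coefficient; the remaining third derivatives then vanish
      one after another.\<close>
    have "J 2 0 x * (Delta x)\<^sup>2 * J 3 0 x = 0"
      using lin unfolding Delta_def by algebra
    then have a: "J 3 0 x = 0" using D E by simp
    then have "J 2 1 x = 0" "J 1 2 x = 0" "J 0 3 x = 0" using lin E by auto
    with a have "flatness x = 0" by (simp add: flatness_def)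
    with nz show False by simp
  qed
qed

end

section \<open>Conjugate directions\<close>

lemma exists_kernel_vector_3:
  fixes r :: "3 \<Rightarrow> 3 \<Rightarrow> real"
  assumes "det (\<chi> i j. r i j) = 0"
  obtains \<alpha> \<beta> \<gamma> where "(\<alpha>, \<beta>, \<gamma>) \<noteq> (0, 0, 0)"
    "\<And>i. \<alpha> * r i 1 + \<beta> * r i 2 + \<gamma> * r i 3 = 0"
proof -
  let ?A = "(\<chi> i j. r i j) :: real^3^3"
  have "\<not> (\<exists>B. B ** ?A = mat 1)"
    using assms invertible_det_nz[of ?A] invertible_left_inverse by blast
  then obtain v where v: "?A *v v = 0" "v \<noteq> 0"
    unfolding matrix_left_invertible_ker by blast
  have "v $ 1 * r i 1 + v $ 2 * r i 2 + v $ 3 * r i 3 = (?A *v v) $ i" for i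
    by (simp add: matrix_vector_mult_def sum_3 algebra_simps)
  moreover have "(v $ 1, v $ 2, v $ 3) \<noteq> (0, 0, 0)"
    using v(2) by (auto simp: vec_eq_iff forall_3)
  ultimately show thesis using that[of "v $ 1" "v $ 2" "v $ 3"] v(1) by simp
qed

text \<open>A nonzero binary form apolar to a definite one has positive discriminant, hence splits
  over the reals into two linear forms that are not proportional.\<close>

lemma quadratic_form_factor:
  fixes \<alpha> \<beta> \<gamma> E F G :: real
  assumes nz: "(\<alpha>, \<beta>, \<gamma>) \<noteq> (0, 0, 0)" and apolar: "\<alpha> * E + \<beta> * F + \<gamma> * G = 0"
    and pos: "E > 0" "G > 0" "E * G - F\<^sup>2 > 0"
  obtains v\<^sub>1 v\<^sub>2 w\<^sub>1 w\<^sub>2 where "v\<^sub>1 * w\<^sub>2 - v\<^sub>2 * w\<^sub>1 \<noteq> 0"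
    "\<alpha> = v\<^sub>1 * w\<^sub>1" "\<beta> = v\<^sub>1 * w\<^sub>2 + v\<^sub>2 * w\<^sub>1" "\<gamma> = v\<^sub>2 * w\<^sub>2"
proof -
  \<comment> \<open>Otherwise squaring the apolarity relation makes \<open>4 * \<alpha> * \<gamma> *
    (E * G - F\<^sup>2) + (\<alpha> * E - \<gamma> * G)\<^sup>2\<close> nonpositive. Both summands
    are nonnegative, so both vanish, and so does the triple.\<close>
  have disc: "\<beta>\<^sup>2 - 4 * \<alpha> * \<gamma> > 0"
  proof (rule ccontr)
    assume "\<not> \<beta>\<^sup>2 - 4 * \<alpha> * \<gamma> > 0"
    then have le: "\<beta>\<^sup>2 \<le> 4 * \<alpha> * \<gamma>" by simp
    have "\<beta> * F = - (\<alpha> * E + \<gamma> * G)" using apolar by simp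
    then have "\<beta>\<^sup>2 * F\<^sup>2 = (\<alpha> * E + \<gamma> * G)\<^sup>2" by (metis power_mult_distrib power2_minus)
    also have "\<dots> = (\<alpha> * E - \<gamma> * G)\<^sup>2 + 4 * \<alpha> * \<gamma> * (E * G)" by (simp add: power2_eq_square algebra_simps)
    finally have "4 * \<alpha> * \<gamma> * (E * G) + (\<alpha> * E - \<gamma> * G)\<^sup>2 = \<beta>\<^sup>2 * F\<^sup>2" by simp
    moreover have "\<beta>\<^sup>2 * F\<^sup>2 \<le> 4 * \<alpha> * \<gamma> * F\<^sup>2" using le by (intro mult_right_mono) auto
    ultimately have sum: "4 * \<alpha> * \<gamma> * (E * G - F\<^sup>2) + (\<alpha> * E - \<gamma> * G)\<^sup>2 \<le> 0"
      by (simp add: algebra_simps)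
    have ag: "4 * \<alpha> * \<gamma> \<ge> 0" using le zero_le_power2[of \<beta>] by linarith
    have "4 * \<alpha> * \<gamma> * (E * G - F\<^sup>2) \<ge> 0" using mult_nonneg_nonneg[OF ag, of "E * G - F\<^sup>2"] pos(3) by simp
    with sum have 1: "4 * \<alpha> * \<gamma> * (E * G - F\<^sup>2) = 0" and 2: "(\<alpha> * E - \<gamma> * G)\<^sup>2 = 0"
      using zero_le_power2[of "\<alpha> * E - \<gamma> * G"] by linarith+
    have "\<alpha> * \<gamma> = 0" using 1 pos by auto
    then have "\<alpha> = 0 \<and> \<gamma> = 0" using 2 pos by auto
    moreover from this have "\<beta> = 0" using le by simp
    ultimately show False using nz by simp
  qed
  define r where "r = sqrt (\<beta>\<^sup>2 - 4 * \<alpha> * \<gamma>)"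
  have r: "r > 0" "r\<^sup>2 = \<beta>\<^sup>2 - 4 * \<alpha> * \<gamma>" using disc by (auto simp: r_def)
  show thesis
  \<comment> \<open>In both cases the witnesses are given in the order \<open>v\<^sub>1\<close>,
    \<open>w\<^sub>2\<close>, \<open>v\<^sub>2\<close>, \<open>w\<^sub>1\<close> in which they first
    occur in the conclusion. For nonzero \<open>\<alpha>\<close> they come from the quadratic
    formula.\<close>
  proof (cases "\<alpha> = 0")
    case True
    then show thesis using disc that[of 0 \<gamma> 1 \<beta>] by simp
  next
    case False
    have "\<gamma> = (\<beta> - r) / 2 * ((\<beta> + r) / (2 * \<alpha>))"
      using False r(2) by (simp add: field_simps power2_eq_square)
    then show thesis using that[of \<alpha> "(\<beta> + r) / (2 * \<alpha>)" "(\<beta> - r) / 2" 1] False r(1)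
      by (simp add: field_simps)
  qed
qed

lemma norm_triple_le: "norm (a, b, c) \<le> \<bar>a\<bar> + \<bar>b\<bar> + \<bar>c\<bar>" for a b c :: real
  using norm_Pair_le[of a "(b, c)"] norm_Pair_le[of b c] by simp

lemma abs_le_norm_triple:
  fixes a b c :: real
  shows "\<bar>a\<bar> \<le> norm (a, b, c)" "\<bar>b\<bar> \<le> norm (a, b, c)" "\<bar>c\<bar> \<le> norm (a, b, c)"
  using norm_fst_le[of a "(b, c)"] norm_snd_le[of "(b, c)" a] norm_fst_le[of b c] norm_snd_le[of c b]
  by auto

lemma linear_combination_bound:
  fixes a b c s t u :: real
  shows "\<bar>a * s + b * t + c * u\<bar> \<le> (\<bar>a\<bar> + \<bar>b\<bar> + \<bar>c\<bar>) * norm (s, t, u)"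
proof -
  have "\<bar>a * s\<bar> \<le> \<bar>a\<bar> * norm (s, t, u)" "\<bar>b * t\<bar> \<le> \<bar>b\<bar> * norm (s, t, u)"
    "\<bar>c * u\<bar> \<le> \<bar>c\<bar> * norm (s, t, u)"
    using abs_le_norm_triple[where a = s and b = t and c = u]
    by (simp_all add: abs_mult mult_left_mono)
  then show ?thesis unfolding distrib_right by linarith
qed

context parallel_cubic_form
begin

section \<open>The closed linear system for constant pairings\<close>

text \<open>The two traces are the partial derivatives of \<open>Delta\<close>, that is,
  \<open>Delta\<close> times the metric trace of the third derivatives.\<close>

definition "dual_trace\<^sub>1 x = J 0 2 x * J 3 0 x - 2 * J 1 1 x * J 2 1 x + J 2 0 x * J 1 2 x" for x
definition "dual_trace\<^sub>2 x = J 0 2 x * J 2 1 x - 2 * J 1 1 x * J 1 2 x + J 2 0 x * J 0 3 x" for x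

text \<open>
  A constant symmetric tensor paired with the second derivatives of \<open>f\<close> gives a function whose
  second derivatives are linear in the function and its gradient: the products of third
  derivatives in the fourth derivatives are reduced by the polarised Cayley-Hamilton identity.
\<close>

lemma pairing_second_derivatives:
  assumes x: "x \<in> \<Omega>"
  fixes \<alpha> \<beta> \<gamma> :: real
  defines "s \<equiv> \<alpha> * J 2 0 x + \<beta> * J 1 1 x + \<gamma> * J 0 2 x"
    and "s\<^sub>1 \<equiv> \<alpha> * J 3 0 x + \<beta> * J 2 1 x + \<gamma> * J 1 2 x"
    and "s\<^sub>2 \<equiv> \<alpha> * J 2 1 x + \<beta> * J 1 2 x + \<gamma> * J 0 3 x"
  shows "2 * Delta x * (\<alpha> * J 4 0 x + \<beta> * J 3 1 x + \<gamma> * J 2 2 x) =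
      - 2 * (J 3 0 x * J 1 2 x - (J 2 1 x)\<^sup>2) * s
      + (J 0 2 x * J 3 0 x - J 1 1 x * J 2 1 x + 2 * dual_trace\<^sub>1 x) * s\<^sub>1
      + (J 2 0 x * J 2 1 x - J 1 1 x * J 3 0 x) * s\<^sub>2"
    "2 * Delta x * (\<alpha> * J 3 1 x + \<beta> * J 2 2 x + \<gamma> * J 1 3 x) =
      - (J 3 0 x * J 0 3 x - J 2 1 x * J 1 2 x) * s
      + (J 0 2 x * J 2 1 x - J 1 1 x * J 1 2 x + dual_trace\<^sub>2 x) * s\<^sub>1
      + (J 2 0 x * J 1 2 x - J 1 1 x * J 2 1 x + dual_trace\<^sub>1 x) * s\<^sub>2"
    "2 * Delta x * (\<alpha> * J 2 2 x + \<beta> * J 1 3 x + \<gamma> * J 0 4 x) =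
      - 2 * (J 2 1 x * J 0 3 x - (J 1 2 x)\<^sup>2) * s
      + (J 0 2 x * J 1 2 x - J 1 1 x * J 0 3 x) * s\<^sub>1
      + (J 2 0 x * J 0 3 x - J 1 1 x * J 1 2 x + 2 * dual_trace\<^sub>2 x) * s\<^sub>2"
proof -
  note expansions = s_def s\<^sub>1_def s\<^sub>2_def dual_trace\<^sub>1_def dual_trace\<^sub>2_def dualprod_def
  note Q = fourth_derivatives[OF x]
  show "2 * Delta x * (\<alpha> * J 4 0 x + \<beta> * J 3 1 x + \<gamma> * J 2 2 x) =
      - 2 * (J 3 0 x * J 1 2 x - (J 2 1 x)\<^sup>2) * s
      + (J 0 2 x * J 3 0 x - J 1 1 x * J 2 1 x + 2 * dual_trace\<^sub>1 x) * s\<^sub>1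
      + (J 2 0 x * J 2 1 x - J 1 1 x * J 3 0 x) * s\<^sub>2"
    using Q(1,2,3) unfolding expansions by algebra
  show "2 * Delta x * (\<alpha> * J 3 1 x + \<beta> * J 2 2 x + \<gamma> * J 1 3 x) =
      - (J 3 0 x * J 0 3 x - J 2 1 x * J 1 2 x) * s
      + (J 0 2 x * J 2 1 x - J 1 1 x * J 1 2 x + dual_trace\<^sub>2 x) * s\<^sub>1
      + (J 2 0 x * J 1 2 x - J 1 1 x * J 2 1 x + dual_trace\<^sub>1 x) * s\<^sub>2"
    using Q(2,3,4) unfolding expansions by algebra
  show "2 * Delta x * (\<alpha> * J 2 2 x + \<beta> * J 1 3 x + \<gamma> * J 0 4 x) =
      - 2 * (J 2 1 x * J 0 3 x - (J 1 2 x)\<^sup>2) * s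
      + (J 0 2 x * J 1 2 x - J 1 1 x * J 0 3 x) * s\<^sub>1
      + (J 2 0 x * J 0 3 x - J 1 1 x * J 1 2 x + 2 * dual_trace\<^sub>2 x) * s\<^sub>2"
    using Q(3,4,5) unfolding expansions by algebra
qed

text \<open>The triple of \<open>s\<close> and its partial derivatives \<open>s\<^sub>1\<close>,
  \<open>s\<^sub>2\<close> solves a homogeneous linear total differential system with continuous
  coefficients, so a zero at \<open>p\<close> propagates over the domain.\<close>

lemma pairing_vanishes:
  fixes \<alpha> \<beta> \<gamma> :: real
  defines "s \<equiv> \<lambda>x. \<alpha> * J 2 0 x + \<beta> * J 1 1 x + \<gamma> * J 0 2 x"
    and "s\<^sub>1 \<equiv> \<lambda>x. \<alpha> * J 3 0 x + \<beta> * J 2 1 x + \<gamma> * J 1 2 x"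
    and "s\<^sub>2 \<equiv> \<lambda>x. \<alpha> * J 2 1 x + \<beta> * J 1 2 x + \<gamma> * J 0 3 x"
  assumes p: "p \<in> \<Omega>" "s p = 0" "s\<^sub>1 p = 0" "s\<^sub>2 p = 0" and x: "x \<in> \<Omega>"
  shows "s x = 0" "s\<^sub>1 x = 0" "s\<^sub>2 x = 0"
proof -
  define V where "V = (\<lambda>x. (s x, s\<^sub>1 x, s\<^sub>2 x))"
  define s\<^sub>1\<^sub>1 where "s\<^sub>1\<^sub>1 = (\<lambda>x. \<alpha> * J 4 0 x + \<beta> * J 3 1 x + \<gamma> * J 2 2 x)"
  define s\<^sub>1\<^sub>2 where "s\<^sub>1\<^sub>2 = (\<lambda>x. \<alpha> * J 3 1 x + \<beta> * J 2 2 x + \<gamma> * J 1 3 x)"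
  define s\<^sub>2\<^sub>2 where "s\<^sub>2\<^sub>2 = (\<lambda>x. \<alpha> * J 2 2 x + \<beta> * J 1 3 x + \<gamma> * J 0 4 x)"
  define V' where "V' = (\<lambda>x h :: real^2. (s\<^sub>1 x * h $ 1 + s\<^sub>2 x * h $ 2,
    s\<^sub>1\<^sub>1 x * h $ 1 + s\<^sub>1\<^sub>2 x * h $ 2, s\<^sub>1\<^sub>2 x * h $ 1 + s\<^sub>2\<^sub>2 x * h $ 2))"
  have dV: "(V has_derivative V' y) (at y)" if "y \<in> \<Omega>" for y
    unfolding V_def V'_def s_def s\<^sub>1_def s\<^sub>2_def s\<^sub>1\<^sub>1_def s\<^sub>1\<^sub>2_def s\<^sub>2\<^sub>2_def
    by (rule derivative_eq_intros has_derivative_Pair has_derivative_dJ[OF that] refl)+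
      (simp add: dJ_def fun_eq_iff algebra_simps eval_nat_numeral)
  have "\<exists>K. \<forall>\<^sub>F y in nhds z. \<forall>h. norm (V' y h) \<le> K * norm (V y) * norm h" if z: "z \<in> \<Omega>" for z
  proof -
    \<comment> \<open>The sum of the absolute values of all nine coefficients of the system, over
      \<open>2 * Delta y\<close>: one continuous function dominating all three second derivatives of
      \<open>s\<close>.\<close>
    define B where "B = (\<lambda>y. (
      \<bar>- 2 * (J 3 0 y * J 1 2 y - (J 2 1 y)\<^sup>2)\<bar>
        + \<bar>J 0 2 y * J 3 0 y - J 1 1 y * J 2 1 y + 2 * dual_trace\<^sub>1 y\<bar>
        + \<bar>J 2 0 y * J 2 1 y - J 1 1 y * J 3 0 y\<bar>
      + (\<bar>- (J 3 0 y * J 0 3 y - J 2 1 y * J 1 2 y)\<bar>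
        + \<bar>J 0 2 y * J 2 1 y - J 1 1 y * J 1 2 y + dual_trace\<^sub>2 y\<bar>
        + \<bar>J 2 0 y * J 1 2 y - J 1 1 y * J 2 1 y + dual_trace\<^sub>1 y\<bar>)
      + (\<bar>- 2 * (J 2 1 y * J 0 3 y - (J 1 2 y)\<^sup>2)\<bar>
        + \<bar>J 0 2 y * J 1 2 y - J 1 1 y * J 0 3 y\<bar>
        + \<bar>J 2 0 y * J 0 3 y - J 1 1 y * J 1 2 y + 2 * dual_trace\<^sub>2 y\<bar>)) / (2 * Delta y))"
    have J: "isCont (J i j) z" for i j
      using has_derivative_continuous[OF has_derivative_dJ[OF z]] by blast
    have "isCont B z"
      using Hessian_positive(2)[OF z] J
      unfolding B_def Delta_def dual_trace\<^sub>1_def dual_trace\<^sub>2_def by (intro continuous_intros) auto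
    then have "(B \<longlongrightarrow> B z) (nhds z)" by (simp add: isCont_def tendsto_at_iff_tendsto_nhds)
    then have "\<forall>\<^sub>F y in nhds z. B y < B z + 1" by (rule order_tendstoD) simp
    moreover have "\<forall>\<^sub>F y in nhds z. y \<in> \<Omega>" using domain(1) z by (rule eventually_nhds_in_open)
    \<comment> \<open>The first component of \<open>V'\<close> contributes 2 to the constant, each
      of the other two \<open>2 * (B z + 1)\<close>.\<close>
    ultimately have "\<forall>\<^sub>F y in nhds z. \<forall>h. norm (V' y h) \<le> (2 + 4 * (B z + 1)) * norm (V y) * norm h"
    proof eventually_elim
      case (elim y)
      define D where "D = 2 * Delta y"
      have D: "D > 0" using Hessian_positive(2)[OF elim(2)] by (simp add: D_def)
      note P = pairing_second_derivatives[OF elim(2), of \<alpha> \<beta> \<gamma>, folded D_def]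
      define n where "n = norm (V y)"
      have V: "norm (s y, s\<^sub>1 y, s\<^sub>2 y) = n" by (simp add: n_def V_def)
      have "\<bar>D * s\<^sub>1\<^sub>1 y\<bar> \<le> D * B y * n \<and> \<bar>D * s\<^sub>1\<^sub>2 y\<bar> \<le> D * B y * n \<and> \<bar>D * s\<^sub>2\<^sub>2 y\<bar> \<le> D * B y * n"
        unfolding s\<^sub>1\<^sub>1_def s\<^sub>1\<^sub>2_def s\<^sub>2\<^sub>2_def P
        by (intro conjI; rule order_trans[OF linear_combination_bound],
            unfold V[unfolded s_def s\<^sub>1_def s\<^sub>2_def], rule mult_right_mono,
            use D in \<open>simp add: B_def D_def\<close>, simp add: n_def)
      then have "D * \<bar>s\<^sub>1\<^sub>1 y\<bar> \<le> D * (B y * n)" "D * \<bar>s\<^sub>1\<^sub>2 y\<bar> \<le> D * (B y * n)" "D * \<bar>s\<^sub>2\<^sub>2 y\<bar> \<le> D * (B y * n)"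
        using D by (simp_all add: abs_mult mult.assoc)
      then have "\<bar>s\<^sub>1\<^sub>1 y\<bar> \<le> B y * n" "\<bar>s\<^sub>1\<^sub>2 y\<bar> \<le> B y * n" "\<bar>s\<^sub>2\<^sub>2 y\<bar> \<le> B y * n"
        using D by simp_all
      moreover have "B y * n \<le> (B z + 1) * n"
        using elim(1) by (intro mult_right_mono) (auto simp: n_def)
      ultimately have s: "\<bar>s\<^sub>1\<^sub>1 y\<bar> \<le> (B z + 1) * n" "\<bar>s\<^sub>1\<^sub>2 y\<bar> \<le> (B z + 1) * n" "\<bar>s\<^sub>2\<^sub>2 y\<bar> \<le> (B z + 1) * n"
        by linarith+
      have g: "\<bar>s\<^sub>1 y\<bar> \<le> n" "\<bar>s\<^sub>2 y\<bar> \<le> n"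
        unfolding n_def V_def by (rule abs_le_norm_triple)+
      have two: "\<bar>a * h $ 1 + b * h $ 2\<bar> \<le> 2 * M * norm h" if "\<bar>a\<bar> \<le> M" "\<bar>b\<bar> \<le> M" for a b M and h :: "real^2"
      proof -
        have "\<bar>a * h $ 1\<bar> \<le> M * norm h" "\<bar>b * h $ 2\<bar> \<le> M * norm h"
          using that component_le_norm_cart[of h] by (auto simp: abs_mult intro!: mult_mono)
        then show ?thesis by linarith
      qed
      show ?case
      proof
        fix h
        have "norm (V' y h) \<le> 2 * n * norm h + 2 * ((B z + 1) * n) * norm h + 2 * ((B z + 1) * n) * norm h"
          unfolding V'_def
          by (rule order_trans[OF norm_triple_le]) (intro add_mono two g s)
        also have "\<dots> = (2 + 4 * (B z + 1)) * n * norm h" by (simp add: algebra_simps)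
        finally show "norm (V' y h) \<le> (2 + 4 * (B z + 1)) * norm (V y) * norm h" by (simp add: n_def)
      qed
    qed
    then show ?thesis by blast
  qed
  then have "V x = 0"
    using zero_propagates[OF domain p(1) _ dV _ x] p by (simp add: V_def zero_prod_def)
  then show "s x = 0" "s\<^sub>1 x = 0" "s\<^sub>2 x = 0" by (simp_all add: V_def zero_prod_def)
qed

text \<open>The conclusions say that the mixed derivative of \<open>f\<close> along \<open>v\<close>
  and \<open>w\<close>, and both its partial derivatives, vanish identically. Flatness at a single
  point supplies the tensor, propagation makes it work everywhere, and factorisation yields the two
  directions.\<close>

lemma conjugate_directions:
  assumes "\<Omega> \<noteq> {}"
  obtains v\<^sub>1 v\<^sub>2 w\<^sub>1 w\<^sub>2 where "v\<^sub>1 * w\<^sub>2 - v\<^sub>2 * w\<^sub>1 \<noteq> 0"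
    "\<And>x. x \<in> \<Omega> \<Longrightarrow> v\<^sub>1 * w\<^sub>1 * J 2 0 x + (v\<^sub>1 * w\<^sub>2 + v\<^sub>2 * w\<^sub>1) * J 1 1 x + v\<^sub>2 * w\<^sub>2 * J 0 2 x = 0"
    "\<And>x. x \<in> \<Omega> \<Longrightarrow> v\<^sub>1 * w\<^sub>1 * J 3 0 x + (v\<^sub>1 * w\<^sub>2 + v\<^sub>2 * w\<^sub>1) * J 2 1 x + v\<^sub>2 * w\<^sub>2 * J 1 2 x = 0"
    "\<And>x. x \<in> \<Omega> \<Longrightarrow> v\<^sub>1 * w\<^sub>1 * J 2 1 x + (v\<^sub>1 * w\<^sub>2 + v\<^sub>2 * w\<^sub>1) * J 1 2 x + v\<^sub>2 * w\<^sub>2 * J 0 3 x = 0"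
proof -
  obtain p where p: "p \<in> \<Omega>" using assms by blast
  \<comment> \<open>The rows are the Hessian and its two partial derivatives at
    \<open>p\<close>.\<close>
  define r :: "3 \<Rightarrow> 3 \<Rightarrow> real" where
    "r i j = (if i = 1 then if j = 1 then J 2 0 p else if j = 2 then J 1 1 p else J 0 2 p
      else if i = 2 then if j = 1 then J 3 0 p else if j = 2 then J 2 1 p else J 1 2 p
      else if j = 1 then J 2 1 p else if j = 2 then J 1 2 p else J 0 3 p)" for i j
  have "det (\<chi> i j. r i j) = flatness p"
    by (simp add: det_3 r_def flatness_def algebra_simps power2_eq_square)
  then obtain \<alpha> \<beta> \<gamma> where nz: "(\<alpha>, \<beta>, \<gamma>) \<noteq> (0, 0, 0)"
    and ker: "\<And>i. \<alpha> * r i 1 + \<beta> * r i 2 + \<gamma> * r i 3 = 0"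
    using exists_kernel_vector_3[of r] flatness_zero[OF p] by metis
  have 0: "\<alpha> * J 2 0 p + \<beta> * J 1 1 p + \<gamma> * J 0 2 p = 0"
    "\<alpha> * J 3 0 p + \<beta> * J 2 1 p + \<gamma> * J 1 2 p = 0"
    "\<alpha> * J 2 1 p + \<beta> * J 1 2 p + \<gamma> * J 0 3 p = 0"
    using ker[of 1] ker[of 2] ker[of 3] by (simp_all add: r_def)
  obtain v\<^sub>1 v\<^sub>2 w\<^sub>1 w\<^sub>2 where vw: "v\<^sub>1 * w\<^sub>2 - v\<^sub>2 * w\<^sub>1 \<noteq> 0"
    "\<alpha> = v\<^sub>1 * w\<^sub>1" "\<beta> = v\<^sub>1 * w\<^sub>2 + v\<^sub>2 * w\<^sub>1" "\<gamma> = v\<^sub>2 * w\<^sub>2"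
    by (rule quadratic_form_factor[OF nz 0(1) Hessian_positive(1)[OF p] Hessian_positive(3)[OF p]
          Hessian_positive(2)[OF p, unfolded Delta_def]])
  show thesis
    by (rule that[OF vw(1)]) (rule pairing_vanishes[OF p 0, unfolded vw(2-4)], assumption)+
qed

end

section \<open>Integration along the conjugate directions\<close>

lemma has_derivative_vec_nth: "((\<lambda>x :: real^'n. x $ i) has_derivative (\<lambda>h. h $ i)) F"
  by (rule bounded_linear_imp_has_derivative[OF bounded_linear_vec_nth])

lemma has_derivative_inverse_sqrt:
  assumes "(h has_derivative h') (at x)" "h x > 0"
  shows "((\<lambda>y. 1 / sqrt (h y)) has_derivative (\<lambda>\<eta>. - ((1 / sqrt (h x)) ^ 3 / 2 * h' \<eta>))) (at x)"
proof -
  have "sqrt (h x) ^ 2 = h x" using assms(2) by simp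
  then show ?thesis
    using assms(2)
    by (auto intro!: derivative_eq_intros assms(1) simp: fun_eq_iff field_simps power3_eq_cube power2_eq_square)
qed

context parallel_cubic_form
begin

text \<open>The second derivative \<open>h\<close> of \<open>f\<close> along \<open>v\<close> has a
  gradient that annihilates \<open>w\<close>, and along \<open>v\<close> it satisfies
  \<open>2 h h'' = 3 h'^2\<close>. This is exactly the vanishing of the second derivative of
  \<open>1 / sqrt h\<close>.\<close>

lemma inverse_sqrt_second_derivative_affine:
  assumes "\<Omega> \<noteq> {}" and \<delta>: "v\<^sub>1 * w\<^sub>2 - v\<^sub>2 * w\<^sub>1 \<noteq> 0"
    and vw: "\<And>x. x \<in> \<Omega> \<Longrightarrow> v\<^sub>1 * w\<^sub>1 * J 2 0 x + (v\<^sub>1 * w\<^sub>2 + v\<^sub>2 * w\<^sub>1) * J 1 1 x + v\<^sub>2 * w\<^sub>2 * J 0 2 x = 0"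
      "\<And>x. x \<in> \<Omega> \<Longrightarrow> v\<^sub>1 * w\<^sub>1 * J 3 0 x + (v\<^sub>1 * w\<^sub>2 + v\<^sub>2 * w\<^sub>1) * J 2 1 x + v\<^sub>2 * w\<^sub>2 * J 1 2 x = 0"
      "\<And>x. x \<in> \<Omega> \<Longrightarrow> v\<^sub>1 * w\<^sub>1 * J 2 1 x + (v\<^sub>1 * w\<^sub>2 + v\<^sub>2 * w\<^sub>1) * J 1 2 x + v\<^sub>2 * w\<^sub>2 * J 0 3 x = 0"
  obtains m n where
    "\<And>x. x \<in> \<Omega> \<Longrightarrow> m * (w\<^sub>2 * x $ 1 - w\<^sub>1 * x $ 2) + n > 0"
    "\<And>x. x \<in> \<Omega> \<Longrightarrow> (v\<^sub>1\<^sup>2 * J 2 0 x + 2 * v\<^sub>1 * v\<^sub>2 * J 1 1 x + v\<^sub>2\<^sup>2 * J 0 2 x)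
        * (m * (w\<^sub>2 * x $ 1 - w\<^sub>1 * x $ 2) + n)\<^sup>2 = 1"
proof -
  define \<delta> where "\<delta> = v\<^sub>1 * w\<^sub>2 - v\<^sub>2 * w\<^sub>1"
  have \<delta>: "\<delta> \<noteq> 0" using assms(2) by (simp add: \<delta>_def)
  \<comment> \<open>The linear form vanishing on \<open>w\<close> and taking the value
    \<open>\<delta>\<close> on \<open>v\<close>.\<close>
  define l where "l = (\<lambda>x :: real^2. w\<^sub>2 * x $ 1 - w\<^sub>1 * x $ 2)"
  define h where "h x = v\<^sub>1\<^sup>2 * J 2 0 x + 2 * v\<^sub>1 * v\<^sub>2 * J 1 1 x + v\<^sub>2\<^sup>2 * J 0 2 x" for x
  define h\<^sub>1 where "h\<^sub>1 x = v\<^sub>1\<^sup>2 * J 3 0 x + 2 * v\<^sub>1 * v\<^sub>2 * J 2 1 x + v\<^sub>2\<^sup>2 * J 1 2 x" for x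
  define h\<^sub>2 where "h\<^sub>2 x = v\<^sub>1\<^sup>2 * J 2 1 x + 2 * v\<^sub>1 * v\<^sub>2 * J 1 2 x + v\<^sub>2\<^sup>2 * J 0 3 x" for x
  \<comment> \<open>The third derivative of \<open>f\<close> along \<open>v\<close>;
    \<open>t\<^sub>1\<close> and \<open>t\<^sub>2\<close> are its partial derivatives.\<close>
  define t where "t x = v\<^sub>1 * h\<^sub>1 x + v\<^sub>2 * h\<^sub>2 x" for x
  define t\<^sub>1 where "t\<^sub>1 x = v\<^sub>1^3 * J 4 0 x + 3 * v\<^sub>1\<^sup>2 * v\<^sub>2 * J 3 1 x + 3 * v\<^sub>1 * v\<^sub>2\<^sup>2 * J 2 2 x + v\<^sub>2^3 * J 1 3 x" for x
  define t\<^sub>2 where "t\<^sub>2 x = v\<^sub>1^3 * J 3 1 x + 3 * v\<^sub>1\<^sup>2 * v\<^sub>2 * J 2 2 x + 3 * v\<^sub>1 * v\<^sub>2\<^sup>2 * J 1 3 x + v\<^sub>2^3 * J 0 4 x" for x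
  have h_pos: "h x > 0" if "x \<in> \<Omega>" for x
  proof -
    have "J 2 0 x * h x = (v\<^sub>1 * J 2 0 x + v\<^sub>2 * J 1 1 x)\<^sup>2 + Delta x * v\<^sub>2\<^sup>2"
      by (simp add: h_def Delta_def algebra_simps power2_eq_square)
    also have "\<dots> > 0"
    proof (cases "v\<^sub>2 = 0")
      case True
      then have "v\<^sub>1 \<noteq> 0" using \<delta> by (auto simp: \<delta>_def)
      with True show ?thesis using Hessian_positive[OF that] by simp
    next
      case False
      then have "Delta x * v\<^sub>2\<^sup>2 > 0" using Hessian_positive[OF that] by simp
      then show ?thesis using zero_le_power2[of "v\<^sub>1 * J 2 0 x + v\<^sub>2 * J 1 1 x"] by linarith
    qed
    finally show ?thesis using Hessian_positive[OF that] by (simp add: zero_less_mult_iff)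
  qed
  have dh: "(h has_derivative (\<lambda>\<eta>. h\<^sub>1 x * \<eta> $ 1 + h\<^sub>2 x * \<eta> $ 2)) (at x)" if "x \<in> \<Omega>" for x
    unfolding h_def h\<^sub>1_def h\<^sub>2_def
    by (rule derivative_eq_intros has_derivative_dJ[OF that] refl)+
      (simp add: dJ_def fun_eq_iff algebra_simps eval_nat_numeral)
  have dt: "(t has_derivative (\<lambda>\<eta>. t\<^sub>1 x * \<eta> $ 1 + t\<^sub>2 x * \<eta> $ 2)) (at x)" if "x \<in> \<Omega>" for x
    unfolding t_def t\<^sub>1_def t\<^sub>2_def h\<^sub>1_def h\<^sub>2_def
    by (rule derivative_eq_intros has_derivative_dJ[OF that] refl)+
      (simp add: dJ_def fun_eq_iff algebra_simps eval_nat_numeral)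
  have hw: "h\<^sub>1 x * w\<^sub>1 + h\<^sub>2 x * w\<^sub>2 = 0" if "x \<in> \<Omega>" for x
    using vw(2,3)[OF that] unfolding h\<^sub>1_def h\<^sub>2_def by algebra
  \<comment> \<open>The gradient of \<open>h\<close> kills \<open>w\<close>, hence is a multiple of
    \<open>l\<close>; evaluation at \<open>v\<close> fixes the factor
    \<open>t x / \<delta>\<close>.\<close>
  have h12: "\<delta> * h\<^sub>1 x = t x * w\<^sub>2" "\<delta> * h\<^sub>2 x = - t x * w\<^sub>1" if "x \<in> \<Omega>" for x
    using hw[OF that] unfolding \<delta>_def t_def by algebra+
  have tw: "t\<^sub>1 x * w\<^sub>1 + t\<^sub>2 x * w\<^sub>2 = 0" if x: "x \<in> \<Omega>" for x
  proof -
    \<comment> \<open>All three splittings pair the gradient of \<open>h\<close> with the gradient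
      of the mixed derivative along \<open>v\<close> and \<open>w\<close>, which is zero.\<close>
    have "2 * Delta x * (t\<^sub>1 x * w\<^sub>1 + t\<^sub>2 x * w\<^sub>2) = 0"
      using fourth_derivatives[OF x] vw(2,3)[OF x]
      unfolding t\<^sub>1_def t\<^sub>2_def dualprod_def by algebra
    then show ?thesis using Hessian_positive(2)[OF x] by simp
  qed
  have tv: "2 * h x * (t\<^sub>1 x * v\<^sub>1 + t\<^sub>2 x * v\<^sub>2) = 3 * (t x)\<^sup>2" if x: "x \<in> \<Omega>" for x
  proof -
    have 1: "2 * Delta x * (t\<^sub>1 x * v\<^sub>1 + t\<^sub>2 x * v\<^sub>2) = 3 * dualprod x (h\<^sub>1 x) (h\<^sub>2 x) (h\<^sub>1 x) (h\<^sub>2 x)"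
      using fourth_derivatives[OF x]
      unfolding t\<^sub>1_def t\<^sub>2_def dualprod_def h\<^sub>1_def h\<^sub>2_def by algebra
    \<comment> \<open>The second derivative of \<open>f\<close> along \<open>w\<close>. As
      \<open>v\<close> and \<open>w\<close> are conjugate, \<open>h x * k\<close> is the Gram
      determinant \<open>Delta x * \<delta>\<^sup>2\<close>, which turns the squared norm of the
      gradient of \<open>h\<close> into \<open>(t x)\<^sup>2 / h x\<close>.\<close>
    define k where "k = w\<^sub>1\<^sup>2 * J 2 0 x + 2 * w\<^sub>1 * w\<^sub>2 * J 1 1 x + w\<^sub>2\<^sup>2 * J 0 2 x"
    have 2: "\<delta>\<^sup>2 * dualprod x (h\<^sub>1 x) (h\<^sub>2 x) (h\<^sub>1 x) (h\<^sub>2 x) = (t x)\<^sup>2 * k"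
      using h12[OF x] unfolding dualprod_def k_def by algebra
    have 3: "h x * k = Delta x * \<delta>\<^sup>2"
      using vw(1)[OF x] unfolding h_def k_def Delta_def \<delta>_def by algebra
    have "Delta x * \<delta>\<^sup>2 * (2 * h x * (t\<^sub>1 x * v\<^sub>1 + t\<^sub>2 x * v\<^sub>2)) = Delta x * \<delta>\<^sup>2 * (3 * (t x)\<^sup>2)"
      using 1 2 3 by algebra
    then show ?thesis using \<delta> Hessian_positive(2)[OF x] by simp
  qed
  have t12: "2 * h x * \<delta> * t\<^sub>1 x = 3 * (t x)\<^sup>2 * w\<^sub>2" "2 * h x * \<delta> * t\<^sub>2 x = - 3 * (t x)\<^sup>2 * w\<^sub>1" if "x \<in> \<Omega>" for x
    using tw[OF that] tv[OF that] unfolding \<delta>_def by algebra+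
  define u where "u x = 1 / sqrt (h x)" for x
  have u: "u x > 0" "h x * (u x)\<^sup>2 = 1" if "x \<in> \<Omega>" for x
    using h_pos[OF that] by (auto simp: u_def power_divide)
  \<comment> \<open>The slope of \<open>u\<close> with respect to \<open>l\<close>, read off from
    the derivative of an inverse square root; its constancy is the differential equation for
    \<open>h\<close>.\<close>
  define \<kappa> where "\<kappa> x = - t x * u x ^ 3 / (2 * \<delta>)" for x
  have du: "(u has_derivative (\<lambda>\<eta>. \<kappa> x * l \<eta>)) (at x)" if x: "x \<in> \<Omega>" for x
  proof -
    have "h\<^sub>1 x * \<eta> $ 1 + h\<^sub>2 x * \<eta> $ 2 = t x * l \<eta> / \<delta>" for \<eta>
    proof -
      have "\<delta> * (h\<^sub>1 x * \<eta> $ 1 + h\<^sub>2 x * \<eta> $ 2) = t x * l \<eta>"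
        using h12[OF x] unfolding l_def by algebra
      then show ?thesis using \<delta> by (simp add: field_simps)
    qed
    then show ?thesis
      using has_derivative_inverse_sqrt[OF dh[OF x] h_pos[OF x]]
      unfolding u_def[abs_def] \<kappa>_def by (simp add: field_simps)
  qed
  have d\<kappa>: "(\<kappa> has_derivative (\<lambda>\<eta>. 0)) (at x)" if x: "x \<in> \<Omega>" for x
  proof -
    have "(\<kappa> has_derivative (\<lambda>\<eta>. (- (t\<^sub>1 x * \<eta> $ 1 + t\<^sub>2 x * \<eta> $ 2) * u x ^ 3
        - 3 * t x * (u x)\<^sup>2 * (\<kappa> x * l \<eta>)) / (2 * \<delta>))) (at x)"
      unfolding \<kappa>_def[abs_def]
      by (rule derivative_eq_intros dt[OF x] du[OF x, unfolded \<kappa>_def] refl | simp add: \<delta>)+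
        (simp add: fun_eq_iff field_simps \<kappa>_def)
    moreover have "- (t\<^sub>1 x * \<eta> $ 1 + t\<^sub>2 x * \<eta> $ 2) * u x ^ 3 - 3 * t x * (u x)\<^sup>2 * (\<kappa> x * l \<eta>) = 0" for \<eta>
    proof -
      have 1: "2 * h x * \<delta> * (t\<^sub>1 x * \<eta> $ 1 + t\<^sub>2 x * \<eta> $ 2) = 3 * (t x)\<^sup>2 * l \<eta>"
        using t12[OF x] unfolding l_def by algebra
      have 2: "2 * \<delta> * \<kappa> x = - t x * u x ^ 3" using \<delta> by (simp add: \<kappa>_def)
      have "2 * \<delta> * h x * (- (t\<^sub>1 x * \<eta> $ 1 + t\<^sub>2 x * \<eta> $ 2) * u x ^ 3 - 3 * t x * (u x)\<^sup>2 * (\<kappa> x * l \<eta>)) = 0"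
        using 1 2 u(2)[OF x] by algebra
      then show ?thesis using \<delta> h_pos[OF x] by simp
    qed
    ultimately show ?thesis by simp
  qed
  obtain p where p: "p \<in> \<Omega>" using assms(1) by blast
  define m where "m = \<kappa> p"
  have \<kappa>: "\<kappa> x = m" if "x \<in> \<Omega>" for x
    unfolding m_def using has_derivative_zero_unique_connected[OF domain d\<kappa> that p] .
  have "((\<lambda>x. u x - m * l x) has_derivative (\<lambda>_. 0)) (at x)" if "x \<in> \<Omega>" for x
    unfolding l_def
    by (rule derivative_eq_intros du[OF that] has_derivative_vec_nth refl)+ (simp add: fun_eq_iff \<kappa>[OF that] l_def)
  from has_derivative_zero_unique_connected[OF domain this _ p]
  have "u x = m * l x + (u p - m * l p)" if "x \<in> \<Omega>" for x using that by (simp add: algebra_simps)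
  then show thesis
    using that[of m "u p - m * l p"] u unfolding l_def h_def by metis
qed

end

section \<open>One-variable profiles\<close>

text \<open>The one-variable summands of the model graphs, each kept with its domain so that
  logarithms are only evaluated at positive arguments.\<close>

definition calabi_profile :: "(real \<Rightarrow> real) \<Rightarrow> real set \<Rightarrow> bool" where
  "calabi_profile \<psi> D \<longleftrightarrow> (\<psi> = (\<lambda>t. 1/2 * t\<^sup>2) \<and> D = UNIV) \<or>
     (\<exists>c>0. \<psi> = (\<lambda>t. - (c * ln t)) \<and> D = {0<..})"

text \<open>Two integrations of the inverse square of an affine function: a square if the function
  is constant, a logarithm otherwise. Integration constants are left to the affine part of
  \<open>f\<close>.\<close>

lemma calabi_profile_exists:
  fixes m n \<delta> :: real
  assumes "\<delta> \<noteq> 0" and "\<exists>t. m * t + n > 0"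
  obtains \<mu> \<nu> \<psi> D \<phi> where "calabi_profile \<psi> D" "\<mu> \<noteq> 0"
    "\<And>t. m * t + n > 0 \<Longrightarrow> \<mu> * t + \<nu> \<in> D"
    "\<And>t. m * t + n > 0 \<Longrightarrow> ((\<lambda>t. \<psi> (\<mu> * t + \<nu>)) has_real_derivative \<phi> t) (at t)"
    "\<And>t. m * t + n > 0 \<Longrightarrow> (\<phi> has_real_derivative 1 / (\<delta>\<^sup>2 * (m * t + n)\<^sup>2)) (at t)"
proof (cases "m = 0")
  case True
  with assms have n: "n > 0" by simp
  \<comment> \<open>Chosen so that \<open>\<mu>\<^sup>2\<close> is the constant second derivative to
    be attained.\<close>
  define \<mu> where "\<mu> = 1 / (n * \<delta>)"
  show thesis
  proof (rule that[of "\<lambda>t. 1/2 * t\<^sup>2" UNIV \<mu> 0 "\<lambda>t. \<mu>\<^sup>2 * t"])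
    show "((\<lambda>t. \<mu>\<^sup>2 * t) has_real_derivative 1 / (\<delta>\<^sup>2 * (m * t + n)\<^sup>2)) (at t)" for t
      using True n assms(1) by (auto intro!: derivative_eq_intros simp: \<mu>_def power_divide power_mult_distrib)
    show "((\<lambda>t. 1/2 * (\<mu> * t + 0)\<^sup>2) has_real_derivative \<mu>\<^sup>2 * t) (at t)" for t
      by (auto intro!: derivative_eq_intros simp: power2_eq_square)
    show "\<mu> \<noteq> 0" using n assms(1) by (simp add: \<mu>_def)
  qed (auto simp: calabi_profile_def)
next
  case False
  \<comment> \<open>The weight that makes \<open>c * m\<^sup>2\<close> equal to
    \<open>1 / \<delta>\<^sup>2\<close>.\<close>
  define c where "c = 1 / (m\<^sup>2 * \<delta>\<^sup>2)"
  have c: "c > 0" using False assms by (simp add: c_def)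
  show thesis
  proof (rule that[of "\<lambda>t. - (c * ln t)" "{0<..}" m n "\<lambda>t. - (c * m / (m * t + n))"])
    fix t assume t: "m * t + n > 0"
    show "((\<lambda>t. - (c * ln (m * t + n))) has_real_derivative - (c * m / (m * t + n))) (at t)"
      using t by (auto intro!: derivative_eq_intros)
    show "((\<lambda>t. - (c * m / (m * t + n))) has_real_derivative 1 / (\<delta>\<^sup>2 * (m * t + n)\<^sup>2)) (at t)"
    proof -
      have "((\<lambda>t. - (c * m / (m * t + n))) has_real_derivative c * m\<^sup>2 / (m * t + n)\<^sup>2) (at t)"
        using t by (auto intro!: derivative_eq_intros simp: power2_eq_square)
      moreover have "c * m\<^sup>2 = 1 / \<delta>\<^sup>2" using False by (simp add: c_def)
      ultimately show ?thesis by simp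
    qed
  qed (use False c in \<open>auto simp: calabi_profile_def\<close>)
qed

lemma has_derivative_profile:
  fixes \<phi> :: "real \<Rightarrow> real" and x :: "real^2"
  assumes "(\<phi> has_real_derivative D) (at (a * x $ 1 - b * x $ 2))"
  shows "((\<lambda>y. \<phi> (a * y $ 1 - b * y $ 2)) has_derivative (\<lambda>\<eta>. D * (a * \<eta> $ 1 - b * \<eta> $ 2))) (at x)"
proof -
  have "((\<lambda>y :: real^2. a * y $ 1 - b * y $ 2) has_derivative (\<lambda>\<eta>. a * \<eta> $ 1 - b * \<eta> $ 2)) (at x)"
    by (rule derivative_eq_intros has_derivative_vec_nth refl)+ simp
  from diff_chain_at[OF this assms[unfolded has_field_derivative_def]]
  show ?thesis by (simp add: o_def)
qed

context parallel_cubic_form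
begin

section \<open>Reconstruction of the function\<close>

text \<open>In the linear coordinates \<open>l\<close> and \<open>k\<close> dual to the conjugate
  directions, up to scale, the Hessian is diagonal with entries integrated by the two profiles.
  Subtracting them from \<open>f\<close> leaves zero Hessian, hence an affine function on the
  connected domain.\<close>

lemma split_representation:
  assumes "\<Omega> \<noteq> {}"
  obtains \<psi>\<^sub>1 D\<^sub>1 a\<^sub>1 b\<^sub>1 \<nu>\<^sub>1 \<psi>\<^sub>2 D\<^sub>2 a\<^sub>2 b\<^sub>2 \<nu>\<^sub>2 q\<^sub>1 q\<^sub>2 r where
    "calabi_profile \<psi>\<^sub>1 D\<^sub>1" "calabi_profile \<psi>\<^sub>2 D\<^sub>2" "a\<^sub>1 * b\<^sub>2 - b\<^sub>1 * a\<^sub>2 \<noteq> 0"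
    "\<And>x. x \<in> \<Omega> \<Longrightarrow> a\<^sub>1 * x $ 1 + b\<^sub>1 * x $ 2 + \<nu>\<^sub>1 \<in> D\<^sub>1"
    "\<And>x. x \<in> \<Omega> \<Longrightarrow> a\<^sub>2 * x $ 1 + b\<^sub>2 * x $ 2 + \<nu>\<^sub>2 \<in> D\<^sub>2"
    "\<And>x. x \<in> \<Omega> \<Longrightarrow> f x = \<psi>\<^sub>1 (a\<^sub>1 * x $ 1 + b\<^sub>1 * x $ 2 + \<nu>\<^sub>1)
        + \<psi>\<^sub>2 (a\<^sub>2 * x $ 1 + b\<^sub>2 * x $ 2 + \<nu>\<^sub>2) + (q\<^sub>1 * x $ 1 + q\<^sub>2 * x $ 2 + r)"
proof -
  obtain v\<^sub>1 v\<^sub>2 w\<^sub>1 w\<^sub>2 where \<delta>: "v\<^sub>1 * w\<^sub>2 - v\<^sub>2 * w\<^sub>1 \<noteq> 0"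
    and vw: "\<And>x. x \<in> \<Omega> \<Longrightarrow> v\<^sub>1 * w\<^sub>1 * J 2 0 x + (v\<^sub>1 * w\<^sub>2 + v\<^sub>2 * w\<^sub>1) * J 1 1 x + v\<^sub>2 * w\<^sub>2 * J 0 2 x = 0"
      "\<And>x. x \<in> \<Omega> \<Longrightarrow> v\<^sub>1 * w\<^sub>1 * J 3 0 x + (v\<^sub>1 * w\<^sub>2 + v\<^sub>2 * w\<^sub>1) * J 2 1 x + v\<^sub>2 * w\<^sub>2 * J 1 2 x = 0"
      "\<And>x. x \<in> \<Omega> \<Longrightarrow> v\<^sub>1 * w\<^sub>1 * J 2 1 x + (v\<^sub>1 * w\<^sub>2 + v\<^sub>2 * w\<^sub>1) * J 1 2 x + v\<^sub>2 * w\<^sub>2 * J 0 3 x = 0"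
    by (rule conjugate_directions[OF assms]) blast
  \<comment> \<open>Exchanging \<open>v\<close> and \<open>w\<close> preserves all hypotheses, so
    the previous result also applies to the second derivative along \<open>w\<close>.\<close>
  have \<delta>': "w\<^sub>1 * v\<^sub>2 - w\<^sub>2 * v\<^sub>1 \<noteq> 0" using \<delta> by (simp add: algebra_simps)
  define l where "l x = w\<^sub>2 * x $ 1 - w\<^sub>1 * x $ 2" for x :: "real^2"
  define k where "k x = v\<^sub>2 * x $ 1 - v\<^sub>1 * x $ 2" for x :: "real^2"
  define h where "h x = v\<^sub>1\<^sup>2 * J 2 0 x + 2 * v\<^sub>1 * v\<^sub>2 * J 1 1 x + v\<^sub>2\<^sup>2 * J 0 2 x" for x
  define g where "g x = w\<^sub>1\<^sup>2 * J 2 0 x + 2 * w\<^sub>1 * w\<^sub>2 * J 1 1 x + w\<^sub>2\<^sup>2 * J 0 2 x" for x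
  obtain m n where mn: "\<And>x. x \<in> \<Omega> \<Longrightarrow> m * l x + n > 0" "\<And>x. x \<in> \<Omega> \<Longrightarrow> h x * (m * l x + n)\<^sup>2 = 1"
    by (rule inverse_sqrt_second_derivative_affine[OF assms \<delta> vw, folded l_def h_def]) blast+
  have wv: "w\<^sub>1 * v\<^sub>1 * J 2 0 x + (w\<^sub>1 * v\<^sub>2 + w\<^sub>2 * v\<^sub>1) * J 1 1 x + w\<^sub>2 * v\<^sub>2 * J 0 2 x = 0"
    "w\<^sub>1 * v\<^sub>1 * J 3 0 x + (w\<^sub>1 * v\<^sub>2 + w\<^sub>2 * v\<^sub>1) * J 2 1 x + w\<^sub>2 * v\<^sub>2 * J 1 2 x = 0"
    "w\<^sub>1 * v\<^sub>1 * J 2 1 x + (w\<^sub>1 * v\<^sub>2 + w\<^sub>2 * v\<^sub>1) * J 1 2 x + w\<^sub>2 * v\<^sub>2 * J 0 3 x = 0"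
    if "x \<in> \<Omega>" for x
    using vw[OF that] by (simp_all add: mult.commute add.commute)
  obtain m' n' where mn': "\<And>x. x \<in> \<Omega> \<Longrightarrow> m' * k x + n' > 0" "\<And>x. x \<in> \<Omega> \<Longrightarrow> g x * (m' * k x + n')\<^sup>2 = 1"
    by (rule inverse_sqrt_second_derivative_affine[OF assms \<delta>' wv, folded k_def g_def]) blast+
  define \<delta> where "\<delta> = v\<^sub>1 * w\<^sub>2 - v\<^sub>2 * w\<^sub>1"
  have \<delta>: "\<delta> \<noteq> 0" using \<delta> by (simp add: \<delta>_def)
  obtain p where p: "p \<in> \<Omega>" using assms by blast
  obtain \<mu> \<nu> \<psi> D \<phi> where P: "calabi_profile \<psi> D" "\<mu> \<noteq> 0"
    "\<And>t. m * t + n > 0 \<Longrightarrow> \<mu> * t + \<nu> \<in> D"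
    "\<And>t. m * t + n > 0 \<Longrightarrow> ((\<lambda>t. \<psi> (\<mu> * t + \<nu>)) has_real_derivative \<phi> t) (at t)"
    "\<And>t. m * t + n > 0 \<Longrightarrow> (\<phi> has_real_derivative 1 / (\<delta>\<^sup>2 * (m * t + n)\<^sup>2)) (at t)"
    by (rule calabi_profile_exists[OF \<delta> exI, OF mn(1)[OF p]]) blast
  \<comment> \<open>The exchanged pair has determinant \<open>- \<delta>\<close>, but only the
    square enters, so the same \<open>\<delta>\<close> serves.\<close>
  obtain \<mu>' \<nu>' \<psi>' D' \<phi>' where P': "calabi_profile \<psi>' D'" "\<mu>' \<noteq> 0"
    "\<And>t. m' * t + n' > 0 \<Longrightarrow> \<mu>' * t + \<nu>' \<in> D'"
    "\<And>t. m' * t + n' > 0 \<Longrightarrow> ((\<lambda>t. \<psi>' (\<mu>' * t + \<nu>')) has_real_derivative \<phi>' t) (at t)"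
    "\<And>t. m' * t + n' > 0 \<Longrightarrow> (\<phi>' has_real_derivative 1 / (\<delta>\<^sup>2 * (m' * t + n')\<^sup>2)) (at t)"
    by (rule calabi_profile_exists[OF \<delta> exI, OF mn'(1)[OF p]]) blast
  have d: "((\<lambda>y. \<psi> (\<mu> * l y + \<nu>)) has_derivative (\<lambda>\<eta>. \<phi> (l x) * l \<eta>)) (at x)"
    "((\<lambda>y. \<psi>' (\<mu>' * k y + \<nu>')) has_derivative (\<lambda>\<eta>. \<phi>' (k x) * k \<eta>)) (at x)"
    "((\<lambda>y. \<phi> (l y)) has_derivative (\<lambda>\<eta>. h x / \<delta>\<^sup>2 * l \<eta>)) (at x)"
    "((\<lambda>y. \<phi>' (k y)) has_derivative (\<lambda>\<eta>. g x / \<delta>\<^sup>2 * k \<eta>)) (at x)" if x: "x \<in> \<Omega>" for x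
  proof -
    have "1 / (\<delta>\<^sup>2 * (m * l x + n)\<^sup>2) = h x / \<delta>\<^sup>2" "1 / (\<delta>\<^sup>2 * (m' * k x + n')\<^sup>2) = g x / \<delta>\<^sup>2"
      using mn[OF x] mn'[OF x] \<delta> by (simp_all add: divide_simps mult.commute)
    then show "((\<lambda>y. \<psi> (\<mu> * l y + \<nu>)) has_derivative (\<lambda>\<eta>. \<phi> (l x) * l \<eta>)) (at x)"
      "((\<lambda>y. \<psi>' (\<mu>' * k y + \<nu>')) has_derivative (\<lambda>\<eta>. \<phi>' (k x) * k \<eta>)) (at x)"
      "((\<lambda>y. \<phi> (l y)) has_derivative (\<lambda>\<eta>. h x / \<delta>\<^sup>2 * l \<eta>)) (at x)"
      "((\<lambda>y. \<phi>' (k y)) has_derivative (\<lambda>\<eta>. g x / \<delta>\<^sup>2 * k \<eta>)) (at x)"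
      using has_derivative_profile[OF P(4)[OF mn(1)[OF x], unfolded l_def], folded l_def]
        has_derivative_profile[OF P'(4)[OF mn'(1)[OF x], unfolded k_def], folded k_def]
        has_derivative_profile[OF P(5)[OF mn(1)[OF x], unfolded l_def], folded l_def]
        has_derivative_profile[OF P'(5)[OF mn'(1)[OF x], unfolded k_def], folded k_def]
      by simp_all
  qed
  have const: "\<exists>q. \<forall>x\<in>\<Omega>. u x = q" if "\<And>x. x \<in> \<Omega> \<Longrightarrow> (u has_derivative (\<lambda>_. 0)) (at x)"
    for u :: "real^2 \<Rightarrow> real"
    using has_derivative_zero_unique_connected[OF domain that _ p] by blast
  \<comment> \<open>Expansion of the Hessian in the squares of \<open>l\<close> and
    \<open>k\<close>; the cross term is absent because \<open>v\<close> and \<open>w\<close> are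
    conjugate.\<close>
  have E: "\<delta>\<^sup>2 * J 2 0 x = h x * w\<^sub>2\<^sup>2 + g x * v\<^sub>2\<^sup>2" "\<delta>\<^sup>2 * J 1 1 x = - (h x * w\<^sub>1 * w\<^sub>2) - g x * v\<^sub>1 * v\<^sub>2"
    "\<delta>\<^sup>2 * J 0 2 x = h x * w\<^sub>1\<^sup>2 + g x * v\<^sub>1\<^sup>2" if "x \<in> \<Omega>" for x
    using vw(1)[OF that] unfolding \<delta>_def h_def g_def by algebra+
  have "((\<lambda>x. J 1 0 x - (\<phi> (l x) * w\<^sub>2 + \<phi>' (k x) * v\<^sub>2)) has_derivative (\<lambda>_. 0)) (at x)"
    if x: "x \<in> \<Omega>" for x
  proof -
    have "J 2 0 x * \<eta> $ 1 + J 1 1 x * \<eta> $ 2 - (h x / \<delta>\<^sup>2 * l \<eta> * w\<^sub>2 + g x / \<delta>\<^sup>2 * k \<eta> * v\<^sub>2) = 0" for \<eta>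
    proof -
      have "\<delta>\<^sup>2 * (J 2 0 x * \<eta> $ 1 + J 1 1 x * \<eta> $ 2) = h x * l \<eta> * w\<^sub>2 + g x * k \<eta> * v\<^sub>2"
        using E[OF x] unfolding l_def k_def by algebra
      then show ?thesis using \<delta> by (simp add: field_simps)
    qed
    then show ?thesis
      using has_derivative_jet[OF x, of 1 0]
      by (auto intro!: derivative_eq_intros d[OF x] simp: eval_nat_numeral)
  qed
  from const[OF this] obtain q\<^sub>1 where q\<^sub>1: "\<And>x. x \<in> \<Omega> \<Longrightarrow> J 1 0 x = \<phi> (l x) * w\<^sub>2 + \<phi>' (k x) * v\<^sub>2 + q\<^sub>1"
    by (metis diff_add_cancel add.commute)
  \<comment> \<open>The sign differs from the previous step because the second coefficients of
    \<open>l\<close> and \<open>k\<close> are \<open>- w\<^sub>1\<close> and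
    \<open>- v\<^sub>1\<close>.\<close>
  have "((\<lambda>x. J 0 1 x + (\<phi> (l x) * w\<^sub>1 + \<phi>' (k x) * v\<^sub>1)) has_derivative (\<lambda>_. 0)) (at x)"
    if x: "x \<in> \<Omega>" for x
  proof -
    have "J 1 1 x * \<eta> $ 1 + J 0 2 x * \<eta> $ 2 + (h x / \<delta>\<^sup>2 * l \<eta> * w\<^sub>1 + g x / \<delta>\<^sup>2 * k \<eta> * v\<^sub>1) = 0" for \<eta>
    proof -
      have "\<delta>\<^sup>2 * (J 1 1 x * \<eta> $ 1 + J 0 2 x * \<eta> $ 2) = - (h x * l \<eta> * w\<^sub>1 + g x * k \<eta> * v\<^sub>1)"
        using E[OF x] unfolding l_def k_def by algebra
      then show ?thesis using \<delta> by (simp add: field_simps)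
    qed
    then show ?thesis
      using has_derivative_jet[OF x, of 0 1]
      by (auto intro!: derivative_eq_intros d[OF x] simp: eval_nat_numeral)
  qed
  from const[OF this] obtain q\<^sub>2 where q\<^sub>2: "\<And>x. x \<in> \<Omega> \<Longrightarrow> J 0 1 x = q\<^sub>2 - (\<phi> (l x) * w\<^sub>1 + \<phi>' (k x) * v\<^sub>1)"
    by (metis add_diff_cancel_right')
  have "((\<lambda>x. f x - \<psi> (\<mu> * l x + \<nu>) - \<psi>' (\<mu>' * k x + \<nu>') - (q\<^sub>1 * x $ 1 + q\<^sub>2 * x $ 2))
      has_derivative (\<lambda>_. 0)) (at x)" if x: "x \<in> \<Omega>" for x
  proof -
    have f: "(f has_derivative (\<lambda>h. J 1 0 x * h $ 1 + J 0 1 x * h $ 2)) (at x)"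
      using has_derivative_jet[OF x, of 0 0] by (simp add: jet_def)
    show ?thesis
      by (rule derivative_eq_intros d[OF x] f has_derivative_vec_nth refl)+
        (simp only: fun_eq_iff q\<^sub>1[OF x] q\<^sub>2[OF x], simp add: l_def k_def algebra_simps)
  qed
  from const[OF this] obtain r where r: "\<And>x. x \<in> \<Omega> \<Longrightarrow>
      f x - \<psi> (\<mu> * l x + \<nu>) - \<psi>' (\<mu>' * k x + \<nu>') - (q\<^sub>1 * x $ 1 + q\<^sub>2 * x $ 2) = r"
    by blast
  have l: "\<mu> * l x + \<nu> = \<mu> * w\<^sub>2 * x $ 1 + - \<mu> * w\<^sub>1 * x $ 2 + \<nu>" for x by (simp add: l_def algebra_simps)
  have k: "\<mu>' * k x + \<nu>' = \<mu>' * v\<^sub>2 * x $ 1 + - \<mu>' * v\<^sub>1 * x $ 2 + \<nu>'" for x by (simp add: k_def algebra_simps)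
  show thesis
  proof (rule that[OF P(1) P'(1)])
    have "\<mu> * w\<^sub>2 * (- \<mu>' * v\<^sub>1) - - \<mu> * w\<^sub>1 * (\<mu>' * v\<^sub>2) = - (\<mu> * \<mu>' * \<delta>)"
      by (simp add: \<delta>_def algebra_simps)
    then show "\<mu> * w\<^sub>2 * (- \<mu>' * v\<^sub>1) - - \<mu> * w\<^sub>1 * (\<mu>' * v\<^sub>2) \<noteq> 0" using P(2) P'(2) \<delta> by simp
    show "\<mu> * w\<^sub>2 * x $ 1 + - \<mu> * w\<^sub>1 * x $ 2 + \<nu> \<in> D" if "x \<in> \<Omega>" for x
      using P(3)[OF mn(1)[OF that]] unfolding l .
    show "\<mu>' * v\<^sub>2 * x $ 1 + - \<mu>' * v\<^sub>1 * x $ 2 + \<nu>' \<in> D'" if "x \<in> \<Omega>" for x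
      using P'(3)[OF mn'(1)[OF that]] unfolding k .
    show "f x = \<psi> (\<mu> * w\<^sub>2 * x $ 1 + - \<mu> * w\<^sub>1 * x $ 2 + \<nu>)
        + \<psi>' (\<mu>' * v\<^sub>2 * x $ 1 + - \<mu>' * v\<^sub>1 * x $ 2 + \<nu>') + (q\<^sub>1 * x $ 1 + q\<^sub>2 * x $ 2 + r)" if "x \<in> \<Omega>" for x
      using r[OF that] unfolding l k by linarith
  qed
qed

end

section \<open>Transport to the model surfaces\<close>

text \<open>The smaller graph is cut out of the larger one by the open cylinder over
  \<open>U\<close>.\<close>

lemma open_part_graph_on:
  assumes "open U" "U \<subseteq> S" "U \<noteq> {}"
  shows "open_part (graph_on U F) (graph_on S F)"
proof -
  have "graph_on U F = graph_on S F \<inter> (U \<times> UNIV)" using assms(2) by (auto simp: graph_on_def)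
  moreover have "open (U \<times> (UNIV :: real set))" using assms(1) by (intro open_Times) auto
  ultimately show ?thesis using assms(3) by (auto simp: open_part_def openin_open graph_on_def)
qed

text \<open>The two affine arguments become the new coordinates, while a vertical shear and
  translation remove the affine remainder. The image is a graph over an open set, since an
  invertible affine map is open.\<close>

lemma calabi_equivalent_split_graph:
  fixes \<Omega> :: "(real^2) set" and \<psi>\<^sub>1 \<psi>\<^sub>2 :: "real \<Rightarrow> real"
  assumes "open \<Omega>" "\<Omega> \<noteq> {}" and det: "a\<^sub>1 * b\<^sub>2 - b\<^sub>1 * a\<^sub>2 \<noteq> 0"
    and D: "\<And>x. x \<in> \<Omega> \<Longrightarrow> a\<^sub>1 * x $ 1 + b\<^sub>1 * x $ 2 + \<nu>\<^sub>1 \<in> D\<^sub>1"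
      "\<And>x. x \<in> \<Omega> \<Longrightarrow> a\<^sub>2 * x $ 1 + b\<^sub>2 * x $ 2 + \<nu>\<^sub>2 \<in> D\<^sub>2"
    and f: "\<And>x. x \<in> \<Omega> \<Longrightarrow> f x = \<psi>\<^sub>1 (a\<^sub>1 * x $ 1 + b\<^sub>1 * x $ 2 + \<nu>\<^sub>1)
        + \<psi>\<^sub>2 (a\<^sub>2 * x $ 1 + b\<^sub>2 * x $ 2 + \<nu>\<^sub>2) + (q\<^sub>1 * x $ 1 + q\<^sub>2 * x $ 2 + r)"
  shows "\<exists>N. calabi_equivalent (graph_on \<Omega> f) N \<and>
    open_part N (graph_on {z. z $ 1 \<in> D\<^sub>1 \<and> z $ 2 \<in> D\<^sub>2} (\<lambda>z. \<psi>\<^sub>1 (z $ 1) + \<psi>\<^sub>2 (z $ 2)))"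
proof -
  define P :: "real^2^2" where "P = vector [vector [a\<^sub>1, b\<^sub>1], vector [a\<^sub>2, b\<^sub>2]]"
  define b :: "real^2" where "b = vector [\<nu>\<^sub>1, \<nu>\<^sub>2]"
  \<comment> \<open>The negative sign makes the shear cancel the linear part of \<open>f\<close>;
    the last translation entry \<open>- r\<close> cancels the constant.\<close>
  define q :: "real^2" where "q = vector [- q\<^sub>1, - q\<^sub>2]"
  define X where "X x = P *v x + b" for x
  define F where "F = (\<lambda>z :: real^2. \<psi>\<^sub>1 (z $ 1) + \<psi>\<^sub>2 (z $ 2))"
  define T where "T = (\<lambda>(x, y). (P *v x, q \<bullet> x + y) + (b, - r))"
  have P: "invertible P" using det by (simp add: invertible_det_nz det_2 P_def)
  have X: "X x $ 1 = a\<^sub>1 * x $ 1 + b\<^sub>1 * x $ 2 + \<nu>\<^sub>1" "X x $ 2 = a\<^sub>2 * x $ 1 + b\<^sub>2 * x $ 2 + \<nu>\<^sub>2" for x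
    by (simp_all add: X_def P_def b_def matrix_vector_mult_def sum_2)
  have "T (x, f x) = (X x, F (X x))" if "x \<in> \<Omega>" for x
    using f[OF that] by (simp add: T_def X_def[symmetric] F_def X) (simp add: q_def inner_vec_def sum_2)
  then have image: "T ` graph_on \<Omega> f = graph_on (X ` \<Omega>) F" by (force simp: graph_on_def image_iff)
  have "calabi_transformation T"
    unfolding calabi_transformation_def T_def
    by (intro exI[of _ P] exI[of _ q] exI[of _ "(b, - r)"] conjI allI P) (simp only: prod.case)
  then have "calabi_equivalent (graph_on \<Omega> f) (graph_on (X ` \<Omega>) F)"
    unfolding calabi_equivalent_def using image by metis
  moreover have "open (X ` \<Omega>)"
  proof -
    have "surj ((*v) P)"
      using matrix_inv_inverse(1)[OF P]
      by (intro surjI[of _ "(*v) (matrix_inv P)"]) (simp add: matrix_vector_mul_assoc)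
    then have "open ((*v) P ` \<Omega>)"
      using open_surjective_linear_image[OF assms(1) matrix_vector_mul_linear] by blast
    then have "open ((\<lambda>z. b + z) ` (*v) P ` \<Omega>)" by (rule open_translation)
    then show ?thesis by (simp add: image_image X_def[abs_def] add.commute)
  qed
  then have "open_part (graph_on (X ` \<Omega>) F) (graph_on {z. z $ 1 \<in> D\<^sub>1 \<and> z $ 2 \<in> D\<^sub>2} F)"
    using D assms(2) by (intro open_part_graph_on) (auto simp: X)
  ultimately show ?thesis unfolding F_def by blast
qed

lemma graph_on_eq_elliptic_paraboloid:
  "graph_on {z. z $ 1 \<in> UNIV \<and> z $ 2 \<in> UNIV} (\<lambda>z. 1/2 * (z $ 1)\<^sup>2 + 1/2 * (z $ 2)\<^sup>2)
    = (elliptic_paraboloid :: ((real^2) \<times> real) set)"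
  by (simp add: elliptic_paraboloid_def sum_2)

lemma graph_on_eq_Q_surface_1:
  "graph_on {z. z $ 1 \<in> {0<..} \<and> z $ 2 \<in> UNIV} (\<lambda>z. - (c * ln (z $ 1)) + 1/2 * (z $ 2)\<^sup>2)
    = (Q_surface (\<lambda>_. c) 1 :: ((real^2) \<times> real) set)"
proof -
  have I: "{Suc (Suc 0)..2} = {2}" by auto
  show ?thesis by (simp add: Q_surface_def I)
qed

lemma graph_on_eq_Q_surface_2:
  "graph_on {z. z $ 1 \<in> {0<..} \<and> z $ 2 \<in> {0<..}} (\<lambda>z. - (c\<^sub>1 * ln (z $ 1)) + - (c\<^sub>2 * ln (z $ 2)))
    = (Q_surface (\<lambda>i. if i = 1 then c\<^sub>1 else c\<^sub>2) 2 :: ((real^2) \<times> real) set)"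
proof -
  have I: "{Suc 0..2} = {1, 2}" by auto
  show ?thesis by (simp add: Q_surface_def I)
qed

theorem corollary1p4:
  fixes \<Omega> :: "(real^2) set" and f :: "real^2 \<Rightarrow> real"
  assumes "\<Omega> \<noteq> {}" and "open \<Omega>" and "connected \<Omega>"
    and "smooth_on \<Omega> f" and "strictly_convex_on \<Omega> f"
    and "parallel3_on \<Omega> (calabi_metric f) (cubic_form f)"
  shows "\<exists>N. calabi_equivalent (graph_on \<Omega> f) N \<and>
    (open_part N elliptic_paraboloid \<or>
     (\<exists>r c. 1 \<le> r \<and> r \<le> 2 \<and> (\<forall>i\<in>{1..r}. c i > 0) \<and> open_part N (Q_surface c r)))"
proof -
  interpret parallel_cubic_form \<Omega> f by unfold_locales (use assms in auto)
  obtain \<psi>\<^sub>1 D\<^sub>1 a\<^sub>1 b\<^sub>1 \<nu>\<^sub>1 \<psi>\<^sub>2 D\<^sub>2 a\<^sub>2 b\<^sub>2 \<nu>\<^sub>2 q\<^sub>1 q\<^sub>2 r where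
    profile: "calabi_profile \<psi>\<^sub>1 D\<^sub>1" "calabi_profile \<psi>\<^sub>2 D\<^sub>2" and det: "a\<^sub>1 * b\<^sub>2 - b\<^sub>1 * a\<^sub>2 \<noteq> 0"
    and D: "\<And>x. x \<in> \<Omega> \<Longrightarrow> a\<^sub>1 * x $ 1 + b\<^sub>1 * x $ 2 + \<nu>\<^sub>1 \<in> D\<^sub>1"
      "\<And>x. x \<in> \<Omega> \<Longrightarrow> a\<^sub>2 * x $ 1 + b\<^sub>2 * x $ 2 + \<nu>\<^sub>2 \<in> D\<^sub>2"
    and f: "\<And>x. x \<in> \<Omega> \<Longrightarrow> f x = \<psi>\<^sub>1 (a\<^sub>1 * x $ 1 + b\<^sub>1 * x $ 2 + \<nu>\<^sub>1)
        + \<psi>\<^sub>2 (a\<^sub>2 * x $ 1 + b\<^sub>2 * x $ 2 + \<nu>\<^sub>2) + (q\<^sub>1 * x $ 1 + q\<^sub>2 * x $ 2 + r)"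
    by (rule split_representation[OF assms(1)]) blast
  \<comment> \<open>\<open>Q_surface\<close> puts logarithmic coordinates before quadratic ones, so
    the case of a square followed by a logarithm needs the two summands exchanged.\<close>
  have det': "a\<^sub>2 * b\<^sub>1 - b\<^sub>2 * a\<^sub>1 \<noteq> 0" using det by (simp add: algebra_simps)
  have f': "f x = \<psi>\<^sub>2 (a\<^sub>2 * x $ 1 + b\<^sub>2 * x $ 2 + \<nu>\<^sub>2) + \<psi>\<^sub>1 (a\<^sub>1 * x $ 1 + b\<^sub>1 * x $ 2 + \<nu>\<^sub>1)
      + (q\<^sub>1 * x $ 1 + q\<^sub>2 * x $ 2 + r)" if "x \<in> \<Omega>" for x using f[OF that] by simp
  note split = calabi_equivalent_split_graph[OF assms(2,1) det D f]
  note split' = calabi_equivalent_split_graph[OF assms(2,1) det' D(2,1) f']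
  consider (quad) "\<psi>\<^sub>1 = (\<lambda>t. 1/2 * t\<^sup>2)" "D\<^sub>1 = UNIV" "\<psi>\<^sub>2 = (\<lambda>t. 1/2 * t\<^sup>2)" "D\<^sub>2 = UNIV"
    | (log_quad) c where "c > 0" "\<psi>\<^sub>1 = (\<lambda>t. - (c * ln t))" "D\<^sub>1 = {0<..}" "\<psi>\<^sub>2 = (\<lambda>t. 1/2 * t\<^sup>2)" "D\<^sub>2 = UNIV"
    | (quad_log) c where "c > 0" "\<psi>\<^sub>2 = (\<lambda>t. - (c * ln t))" "D\<^sub>2 = {0<..}" "\<psi>\<^sub>1 = (\<lambda>t. 1/2 * t\<^sup>2)" "D\<^sub>1 = UNIV"
    | (log_log) c\<^sub>1 c\<^sub>2 where "c\<^sub>1 > 0" "\<psi>\<^sub>1 = (\<lambda>t. - (c\<^sub>1 * ln t))" "D\<^sub>1 = {0<..}"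
        "c\<^sub>2 > 0" "\<psi>\<^sub>2 = (\<lambda>t. - (c\<^sub>2 * ln t))" "D\<^sub>2 = {0<..}"
    using profile unfolding calabi_profile_def by blast
  then show ?thesis
  proof cases
    case quad
    show ?thesis using split unfolding quad graph_on_eq_elliptic_paraboloid by blast
  next
    case log_quad
    obtain N where "calabi_equivalent (graph_on \<Omega> f) N" "open_part N (Q_surface (\<lambda>_. c) 1)"
      using split unfolding log_quad graph_on_eq_Q_surface_1 by blast
    then show ?thesis
      using log_quad(1) by (intro exI[of _ N] conjI disjI2 exI[of _ 1] exI[of _ "\<lambda>_. c"]) auto
  next
    case quad_log
    obtain N where "calabi_equivalent (graph_on \<Omega> f) N" "open_part N (Q_surface (\<lambda>_. c) 1)"
      using split' unfolding quad_log graph_on_eq_Q_surface_1 by blast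
    then show ?thesis
      using quad_log(1) by (intro exI[of _ N] conjI disjI2 exI[of _ 1] exI[of _ "\<lambda>_. c"]) auto
  next
    case log_log
    obtain N where "calabi_equivalent (graph_on \<Omega> f) N"
      "open_part N (Q_surface (\<lambda>i. if i = 1 then c\<^sub>1 else c\<^sub>2) 2)"
      using split unfolding log_log graph_on_eq_Q_surface_2 by blast
    then show ?thesis
      using log_log(1,4)
      by (intro exI[of _ N] conjI disjI2 exI[of _ 2] exI[of _ "\<lambda>i. if i = 1 then c\<^sub>1 else c\<^sub>2"]) auto
  qed
qed

end
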